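(* Let $\Omega$ be a non-empty closed discrete subset of $\mathbb C$. Then the space $\hat{\mathscr R}_\Omega$ is stable under convolution if and only if $\Omega$ is stable under addition.
   Context: For $R>0$, $\mathbb D_R^*=\{0<|\zeta|<R\}$. A holomorphic germ $\hat\varphi(\zeta)\in\mathbb C\{\zeta\}$ at $0$ is called $\Omega$-continuable if there exists $R>0$ not larger than the radius of convergence of $\hat\varphi$ such that $\mathbb D_R^*\cap\Omega=\emptyset$ and $\hat\varphi$ admits analytic continuation along any path of $\mathbb C\setminus\Omega$ originating from any point of $\mathbb D_R^*$ (paths are continuous, piecewise continuously differentiable maps from a compact interval). $\hat{\mathscr R}_\Omega\subset\mathbb C\{\zeta\}$ is the set of all $\Omega$-continuable germs. The convolution of two germs is the germ $\hat\varphi*\hat\psi(\zeta)=\int_0^\zeta\hat\varphi(\xi)\hat\psi(\zeta-\xi)\,d\xi$ for $|\zeta|$ small enough. "Stable under convolution" means $\hat\varphi,\hat\psi\in\hat{\mathscr R}_\Omega\Rightarrow\hat\varphi*\hat\psi\in\hat{\mathscr R}_\Omega$; "stable under addition" means $\omega,\omega'\in\Omega\Rightarrow\omega+\omega'\in\Omega$. *)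

theory Defs
  imports "HOL-Complex_Analysis.Complex_Analysis"
begin

text \<open>
  The holomorphic germs at \<open>0\<close>, \<open>\<complex>{\<zeta>}\<close>, are represented by their Taylor series: elements
  \<open>\<phi> :: complex fps\<close> with \<open>fps_conv_radius \<phi> > 0\<close>; \<open>eval_fps \<phi>\<close> is the function
  defined by the germ on its disc of convergence.
\<close>

definition punctured_disc :: "real \<Rightarrow> complex set" where
  "punctured_disc R = {\<zeta>. 0 < norm \<zeta> \<and> norm \<zeta> < R}"

text \<open>
  \<open>F t\<close> represents the germ at \<open>\<gamma> t\<close> obtained by continuing, along \<open>\<gamma>\<close> restricted to \<open>[0, t]\<close>,
  the germ of \<open>f\<close> at \<open>\<gamma> 0\<close>: nearby germs of the family are direct continuations of one another.
  Only the germ of \<open>F t\<close> at \<open>\<gamma> t\<close> matters.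
\<close>

definition continuation_along ::
    "(complex \<Rightarrow> complex) \<Rightarrow> (real \<Rightarrow> complex) \<Rightarrow> (real \<Rightarrow> complex \<Rightarrow> complex) \<Rightarrow> bool" where
  "continuation_along f \<gamma> F \<longleftrightarrow>
     (\<forall>t\<in>{0..1}. F t analytic_on {\<gamma> t}) \<and>
     (\<forall>\<^sub>F z in nhds (\<gamma> 0). F 0 z = f z) \<and>
     (\<forall>t\<in>{0..1}. \<forall>\<^sub>F s in at t within {0..1}. \<forall>\<^sub>F z in nhds (\<gamma> s). F s z = F t z)"

definition continuable_along :: "(complex \<Rightarrow> complex) \<Rightarrow> (real \<Rightarrow> complex) \<Rightarrow> bool" where
  "continuable_along f \<gamma> \<longleftrightarrow> (\<exists>F. continuation_along f \<gamma> F)"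

text \<open>
  Since \<open>R > 0\<close>, the bound on \<open>R\<close> also makes \<open>\<phi>\<close> a convergent series. Paths defined on a
  compact interval are taken to be parametrised by \<open>[0, 1]\<close>, as usual in the library.
\<close>

definition Omega_continuable :: "complex set \<Rightarrow> complex fps \<Rightarrow> bool" where
  "Omega_continuable \<Omega> \<phi> \<longleftrightarrow>
     (\<exists>R>0. ereal R \<le> fps_conv_radius \<phi> \<and> punctured_disc R \<inter> \<Omega> = {} \<and>
        (\<forall>\<gamma>. valid_path \<gamma> \<and> path_image \<gamma> \<subseteq> - \<Omega> \<and> pathstart \<gamma> \<in> punctured_disc R \<longrightarrow>
           continuable_along (eval_fps \<phi>) \<gamma>))"

definition continuable_germs :: "complex set \<Rightarrow> complex fps set" where
  "continuable_germs \<Omega> = {\<phi>. Omega_continuable \<Omega> \<phi>}"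

definition germ_convolution :: "complex fps \<Rightarrow> complex fps \<Rightarrow> complex fps" where
  "germ_convolution \<phi> \<psi> =
     fps_expansion (\<lambda>\<zeta>. contour_integral (linepath 0 \<zeta>) (\<lambda>\<xi>. eval_fps \<phi> \<xi> * eval_fps \<psi> (\<zeta> - \<xi>))) 0"

text \<open>The convolution integral is holomorphic near \<open>0\<close>, so its Taylor series is its germ at \<open>0\<close>:\<close>

lemma germ_convolution_has_fps_expansion:
  assumes "fps_conv_radius \<phi> > 0" "fps_conv_radius \<psi> > 0"
  shows "(\<lambda>\<zeta>. contour_integral (linepath 0 \<zeta>) (\<lambda>\<xi>. eval_fps \<phi> \<xi> * eval_fps \<psi> (\<zeta> - \<xi>)))
           has_fps_expansion germ_convolution \<phi> \<psi>"
proof -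
  obtain r where r: "0 < ereal r" "ereal r < min (fps_conv_radius \<phi>) (fps_conv_radius \<psi>)"
    using ereal_dense2[of 0 "min (fps_conv_radius \<phi>) (fps_conv_radius \<psi>)"] assms by auto
  have r0: "r > 0" using r by simp
  let ?U = "ball (0::complex) r"
  let ?g = "\<lambda>\<zeta> t. eval_fps \<phi> (t *\<^sub>R \<zeta>) * eval_fps \<psi> ((1 - t) *\<^sub>R \<zeta>) * \<zeta>"
  let ?g' = "\<lambda>\<zeta> t. (eval_fps (fps_deriv \<phi>) (t *\<^sub>R \<zeta>) * of_real t * eval_fps \<psi> ((1 - t) *\<^sub>R \<zeta>)
              + eval_fps \<phi> (t *\<^sub>R \<zeta>) * (eval_fps (fps_deriv \<psi>) ((1 - t) *\<^sub>R \<zeta>) * of_real (1 - t))) * \<zeta>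
              + eval_fps \<phi> (t *\<^sub>R \<zeta>) * eval_fps \<psi> ((1 - t) *\<^sub>R \<zeta>)"
  have nr: "ereal (norm z) < fps_conv_radius \<phi>" "ereal (norm z) < fps_conv_radius \<psi>"
    if "z \<in> ?U" for z
    using that r by (auto intro: less_trans[of _ "ereal r"])
  have sc: "t *\<^sub>R z \<in> ?U" if "z \<in> ?U" "t \<in> {0..1}" for z and t :: real
    using that mult_right_mono[of t 1 "norm z"] by auto
  have cont: "continuous_on ?U (eval_fps F)"
    if "F \<in> {\<phi>, \<psi>, fps_deriv \<phi>, fps_deriv \<psi>}" for F
  proof -
    have "ereal r \<le> fps_conv_radius F"
      using that r fps_conv_radius_deriv[of \<phi>] fps_conv_radius_deriv[of \<psi>]
      by (auto intro: order.trans[OF less_imp_le])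
    then have "?U \<subseteq> eball 0 (fps_conv_radius F)"
      by (auto simp: in_eball_iff) (meson ereal_less(2) ereal_less_eq(3) less_ereal.simps(1) less_le_trans)
    then show ?thesis by (rule continuous_on_eval_fps[THEN continuous_on_subset])
  qed
  have comp: "continuous_on X (\<lambda>x. eval_fps F (h x))"
    if "F \<in> {\<phi>, \<psi>, fps_deriv \<phi>, fps_deriv \<psi>}" "continuous_on X h" "h ` X \<subseteq> ?U"
    for F h and X :: "'x::topological_space set"
    using continuous_on_compose2[OF cont[OF that(1)] that(2,3)] .
  have der: "((\<lambda>\<zeta>. ?g \<zeta> t) has_field_derivative ?g' z t) (at z within ?U)"
    if z: "z \<in> ?U" and t: "t \<in> cbox 0 1" for z t
  proof -
    have "((\<lambda>\<zeta>. eval_fps \<phi> (of_real t * \<zeta>) * eval_fps \<psi> (of_real (1 - t) * \<zeta>) * \<zeta>)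
        has_field_derivative ?g' z t) (at z within ?U)"
      using nr[OF sc[OF z, of t]] nr[OF sc[OF z, of "1 - t"]] t
      by (auto intro!: derivative_eq_intros has_field_derivative_eval_fps'
               simp: scaleR_conv_of_real algebra_simps in_eball_iff)
    then show ?thesis by (simp add: scaleR_conv_of_real)
  qed
  have "(\<lambda>\<zeta>. integral (cbox 0 1) (?g \<zeta>)) holomorphic_on ?U"
  proof (rule leibniz_rule_holomorphic[OF der])
    show "?g z integrable_on cbox 0 1" if "z \<in> ?U" for z
      using sc[OF that] by (intro integrable_continuous continuous_intros comp) auto
    show "continuous_on (?U \<times> cbox 0 1) (\<lambda>(z, t). ?g' z t)"
    proof -
      have c1: "continuous_on (?U \<times> cbox 0 1) (\<lambda>x. eval_fps F (snd x *\<^sub>R fst x))"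
        and c2: "continuous_on (?U \<times> cbox 0 1) (\<lambda>x. eval_fps F ((1 - snd x) *\<^sub>R fst x))"
        if "F \<in> {\<phi>, \<psi>, fps_deriv \<phi>, fps_deriv \<psi>}" for F
      proof -
        have "(\<lambda>x. snd x *\<^sub>R fst x) ` (?U \<times> cbox 0 1) \<subseteq> ?U"
          "(\<lambda>x. (1 - snd x) *\<^sub>R fst x) ` (?U \<times> cbox 0 1) \<subseteq> ?U"
          by (rule image_subsetI, rule sc, force, force)+
        then show "continuous_on (?U \<times> cbox 0 1) (\<lambda>x. eval_fps F (snd x *\<^sub>R fst x))"
          "continuous_on (?U \<times> cbox 0 1) (\<lambda>x. eval_fps F ((1 - snd x) *\<^sub>R fst x))"
          by - (rule comp[OF that], intro continuous_intros, assumption)+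
      qed
      show ?thesis
        unfolding case_prod_unfold
        by (intro continuous_on_add continuous_on_mult c1 c2 continuous_on_of_real
              continuous_on_diff continuous_on_const continuous_on_fst continuous_on_snd
              continuous_on_id) auto
    qed
  qed auto
  also have "(\<lambda>\<zeta>. integral (cbox 0 1) (?g \<zeta>)) =
      (\<lambda>\<zeta>. contour_integral (linepath 0 \<zeta>) (\<lambda>\<xi>. eval_fps \<phi> \<xi> * eval_fps \<psi> (\<zeta> - \<xi>)))"
    by (simp add: contour_integral_integral linepath_def algebra_simps)
  finally show ?thesis
    unfolding germ_convolution_def using r0
    by (intro has_fps_expansion_fps_expansion[of ?U]) auto
qed

end

theory Submission
  imports Defs
begin

text \<open>
  If \<open>\<omega>\<^sub>1, \<omega>\<^sub>2 \<in> \<Omega> - {0}\<close> but \<open>\<omega> = \<omega>\<^sub>1 + \<omega>\<^sub>2 \<notin> \<Omega>\<close>, take the germs of \<open>1/(\<omega>\<^sub>1 - \<zeta>)\<close> and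
  \<open>1/(\<omega>\<^sub>2 - \<zeta>)\<close>. Multiplied by \<open>\<omega> - \<zeta>\<close>, their convolution becomes a primitive of
  \<open>r = 1/(\<omega>\<^sub>1 - \<zeta>) + 1/(\<omega>\<^sub>2 - \<zeta>)\<close>. If the convolution could be continued to \<open>\<omega>\<close>, this primitive would
  vanish there whatever the path, so every loop at \<open>\<omega>\<close> would have \<open>\<integral> r = 0\<close>; a loop around
  \<open>\<omega>\<^sub>1\<close> does not.

  Conversely, the convolution is continued along \<open>\<gamma>\<close> by integrating over paths \<open>H\<close> from \<open>0\<close> to
  \<open>\<gamma>(t)\<close> that avoid \<open>\<Omega>\<close> and are symmetric, \<open>H(s) + H(1 - s) = \<gamma>(t)\<close>. They are obtained by moving
  the points of the initial segment in finitely many small steps: \<open>H(s)\<close> moves by a fraction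
  \<open>a(s)/(a(s) + a(1 - s))\<close> of the increment of \<open>\<gamma>\<close>, where \<open>a(s)\<close> vanishes when \<open>H(s)\<close> is within
  \<open>\<delta>\<close> of \<open>\<Omega>\<close>. A point can thus never come closer to \<open>\<Omega>\<close> than \<open>\<delta>/2\<close>, however many steps
  are made, and \<open>a(s)\<close> and \<open>a(1 - s)\<close> do not vanish together because \<open>\<gamma>(t) = H(s) + H(1 - s)\<close> stays
  far from \<open>\<Omega> + \<Omega> \<subseteq> \<Omega>\<close>. Consecutive integrals agree by Cauchy's theorem.
\<close>

subsection \<open>Coherent families of germs along a path\<close>

text \<open>The same notion as \<open>continuation_along\<close>, over an arbitrary parameter set
  and with no prescribed initial germ, so that families can be restricted to parts of the interval,
  reparametrised and pasted together.\<close>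

definition coherent_along :: "real set \<Rightarrow> (real \<Rightarrow> complex) \<Rightarrow> (real \<Rightarrow> complex \<Rightarrow> complex) \<Rightarrow> bool" where
  "coherent_along S \<gamma> F \<longleftrightarrow>
     (\<forall>t\<in>S. F t analytic_on {\<gamma> t}) \<and>
     (\<forall>t\<in>S. \<exists>d>0. \<forall>s\<in>S. dist s t < d \<longrightarrow> (\<forall>\<^sub>F z in nhds (\<gamma> s). F s z = F t z))"

lemma coherent_along_analytic: "coherent_along S \<gamma> F \<Longrightarrow> t \<in> S \<Longrightarrow> F t analytic_on {\<gamma> t}"
  by (simp add: coherent_along_def)

lemma coherent_alongE:
  assumes "coherent_along S \<gamma> F" "t \<in> S"
  obtains d where "d > 0" "\<And>s. s \<in> S \<Longrightarrow> dist s t < d \<Longrightarrow> \<forall>\<^sub>F z in nhds (\<gamma> s). F s z = F t z"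
  using assms unfolding coherent_along_def by blast

lemma coherent_along_nhd:
  assumes "coherent_along S \<gamma> F" "t \<in> S" "continuous_on S \<gamma>" "e > 0"
  obtains d where "d > 0"
    "\<And>s. s \<in> S \<Longrightarrow> dist s t < d \<Longrightarrow> \<gamma> s \<in> ball (\<gamma> t) e \<and> (\<forall>\<^sub>F z in nhds (\<gamma> s). F s z = F t z)"
proof -
  obtain d1 where "d1 > 0" and d1: "\<And>s. s \<in> S \<Longrightarrow> dist s t < d1 \<Longrightarrow> \<forall>\<^sub>F z in nhds (\<gamma> s). F s z = F t z"
    using coherent_alongE[OF assms(1,2)] by metis
  obtain d2 where "d2 > 0" and d2: "\<And>s. s \<in> S \<Longrightarrow> dist s t < d2 \<Longrightarrow> dist (\<gamma> s) (\<gamma> t) < e"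
    using assms unfolding continuous_on_iff by metis
  show thesis
    using d1 d2 \<open>d1 > 0\<close> \<open>d2 > 0\<close> by (intro that[of "min d1 d2"]) (auto simp: dist_commute)
qed

lemma continuation_along_iff:
  "continuation_along f \<gamma> F \<longleftrightarrow>
     coherent_along {0..1} \<gamma> F \<and> (\<forall>\<^sub>F z in nhds (\<gamma> 0). F 0 z = f z)"
proof -
  have "(s \<noteq> t \<and> dist s t < d \<longrightarrow> (\<forall>\<^sub>F z in nhds (\<gamma> s). F s z = F t z)) \<longleftrightarrow>
      (dist s t < d \<longrightarrow> (\<forall>\<^sub>F z in nhds (\<gamma> s). F s z = F t z))" for s t d
    by (cases "s = t") auto
  then show ?thesis
    unfolding continuation_along_def coherent_along_def eventually_at by auto
qed

lemma coherent_along_compose: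
  assumes "coherent_along S \<gamma> F" "continuous_on T h" "h ` T \<subseteq> S"
  shows "coherent_along T (\<lambda>t. \<gamma> (h t)) (\<lambda>t. F (h t))"
  unfolding coherent_along_def
proof (intro conjI ballI)
  fix t assume t: "t \<in> T"
  then have ht: "h t \<in> S" using assms by auto
  then show "F (h t) analytic_on {\<gamma> (h t)}"
    using assms(1) by (simp add: coherent_along_def)
  obtain d where d: "d > 0" "\<And>s. s \<in> S \<Longrightarrow> dist s (h t) < d \<Longrightarrow> \<forall>\<^sub>F z in nhds (\<gamma> s). F s z = F (h t) z"
    using coherent_alongE[OF assms(1) ht] by metis
  obtain e where "e > 0" "\<And>s. s \<in> T \<Longrightarrow> dist s t < e \<Longrightarrow> dist (h s) (h t) < d"
    using assms(2) t d(1) unfolding continuous_on_iff by metis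
  then show "\<exists>d>0. \<forall>s\<in>T. dist s t < d \<longrightarrow> (\<forall>\<^sub>F z in nhds (\<gamma> (h s)). F (h s) z = F (h t) z)"
    using d(2) assms(3) by (intro exI[of _ e]) auto
qed

lemma coherent_along_subset: "coherent_along S \<gamma> F \<Longrightarrow> T \<subseteq> S \<Longrightarrow> coherent_along T \<gamma> F"
  unfolding coherent_along_def by (meson subsetD)

lemma coherent_along_const:
  assumes "\<And>t. t \<in> S \<Longrightarrow> f analytic_on {\<gamma> t}"
  shows "coherent_along S \<gamma> (\<lambda>_. f)"
  unfolding coherent_along_def using assms by (auto intro: exI[of _ 1])

lemma coherent_along_diff:
  assumes "coherent_along S \<gamma> F" "coherent_along S \<gamma> G"
  shows "coherent_along S \<gamma> (\<lambda>t z. F t z - G t z)"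
  unfolding coherent_along_def
proof (intro conjI ballI)
  fix t assume t: "t \<in> S"
  show "(\<lambda>z. F t z - G t z) analytic_on {\<gamma> t}"
    using assms t by (auto simp: coherent_along_def intro: analytic_intros)
  obtain d where d: "d > 0" "\<And>s. s \<in> S \<Longrightarrow> dist s t < d \<Longrightarrow> \<forall>\<^sub>F z in nhds (\<gamma> s). F s z = F t z"
    using coherent_alongE[OF assms(1) t] by metis
  obtain d' where d': "d' > 0" "\<And>s. s \<in> S \<Longrightarrow> dist s t < d' \<Longrightarrow> \<forall>\<^sub>F z in nhds (\<gamma> s). G s z = G t z"
    using coherent_alongE[OF assms(2) t] by metis
  have "\<forall>\<^sub>F z in nhds (\<gamma> s). F s z - G s z = F t z - G t z" if "s \<in> S" "dist s t < min d d'" for s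
    using d(2)[of s] d'(2)[of s] that by (auto elim: eventually_elim2)
  then show "\<exists>d>0. \<forall>s\<in>S. dist s t < d \<longrightarrow> (\<forall>\<^sub>F z in nhds (\<gamma> s). F s z - G s z = F t z - G t z)"
    using d(1) d'(1) by (intro exI[of _ "min d d'"]) auto
qed

text \<open>Near t every \<open>F s\<close> has at \<open>\<gamma> s\<close> the germ of the one
  function \<open>F t\<close>, holomorphic on a ball. By the identity theorem on that ball,
  vanishing of the germ is a locally constant property of the parameter, and S is connected.\<close>

lemma coherent_along_zero:
  assumes coh: "coherent_along S \<gamma> F" and "connected S" "continuous_on S \<gamma>"
    and "a \<in> S" "b \<in> S" "\<forall>\<^sub>F z in nhds (\<gamma> a). F a z = 0"
  shows "\<forall>\<^sub>F z in nhds (\<gamma> b). F b z = 0"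
proof (rule connected_induction_simple[of S a b "\<lambda>t. \<forall>\<^sub>F z in nhds (\<gamma> t). F t z = 0"])
  fix t assume t: "t \<in> S"
  obtain e where e: "e > 0" "F t holomorphic_on ball (\<gamma> t) e"
    using coherent_along_analytic[OF coh t] unfolding analytic_on_def by auto
  obtain d where d: "d > 0" "\<And>s. s \<in> S \<Longrightarrow> dist s t < d \<Longrightarrow>
      \<gamma> s \<in> ball (\<gamma> t) e \<and> (\<forall>\<^sub>F z in nhds (\<gamma> s). F s z = F t z)"
    using coherent_along_nhd[OF coh t assms(3) e(1)] by metis
  have *: "\<forall>\<^sub>F z in nhds (\<gamma> y). F y z = 0"
    if xy: "x \<in> S" "dist x t < d" "y \<in> S" "dist y t < d" and x0: "\<forall>\<^sub>F z in nhds (\<gamma> x). F x z = 0" for x y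
  proof -
    have "\<forall>\<^sub>F z in nhds (\<gamma> x). F t z = 0"
      using d(2)[OF xy(1,2)] x0 by (auto elim: eventually_elim2)
    moreover have "\<forall>\<^sub>F z in nhds (\<gamma> x). z \<in> ball (\<gamma> t) e"
      using d(2)[OF xy(1,2)] by (intro eventually_nhds_in_open) auto
    ultimately have "\<forall>\<^sub>F z in nhds (\<gamma> x). F t z = 0 \<and> z \<in> ball (\<gamma> t) e"
      by (rule eventually_conj)
    then obtain U where U: "open U" "\<gamma> x \<in> U" "\<And>z. z \<in> U \<Longrightarrow> F t z = 0 \<and> z \<in> ball (\<gamma> t) e"
      unfolding eventually_nhds by blast
    have z: "F t z = 0" if "z \<in> ball (\<gamma> t) e" for z
      by (rule analytic_continuation_open[of U "ball (\<gamma> t) e" "F t" "\<lambda>_. 0"])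
         (use U e that in auto)
    have "\<forall>\<^sub>F z in nhds (\<gamma> y). z \<in> ball (\<gamma> t) e"
      using d(2)[OF xy(3,4)] by (intro eventually_nhds_in_open) auto
    moreover have "\<forall>\<^sub>F z in nhds (\<gamma> y). F y z = F t z"
      using d(2)[OF xy(3,4)] by simp
    ultimately show ?thesis
      by eventually_elim (simp add: z)
  qed
  show "\<exists>T. openin (top_of_set S) T \<and> t \<in> T \<and>
      (\<forall>x\<in>T. \<forall>y\<in>T. (\<forall>\<^sub>F z in nhds (\<gamma> x). F x z = 0) \<longrightarrow> (\<forall>\<^sub>F z in nhds (\<gamma> y). F y z = 0))"
  proof (intro exI[of _ "S \<inter> ball t d"] conjI ballI impI)
    show "\<forall>\<^sub>F z in nhds (\<gamma> y). F y z = 0"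
      if "x \<in> S \<inter> ball t d" "y \<in> S \<inter> ball t d" "\<forall>\<^sub>F z in nhds (\<gamma> x). F x z = 0" for x y
      using *[OF _ _ _ _ that(3)] that(1,2) by (simp add: dist_commute)
  qed (use t d(1) in \<open>auto intro: openin_open_Int\<close>)
qed (use assms in auto)

text \<open>Uniqueness of analytic continuation: the difference of the two families is coherent and
  its germ vanishes at a.\<close>

lemma coherent_along_unique:
  assumes "coherent_along S \<gamma> F" "coherent_along S \<gamma> G" "connected S" "continuous_on S \<gamma>"
    and "a \<in> S" "b \<in> S" "\<forall>\<^sub>F z in nhds (\<gamma> a). F a z = G a z"
  shows "\<forall>\<^sub>F z in nhds (\<gamma> b). F b z = G b z"
  using coherent_along_zero[OF coherent_along_diff[OF assms(1,2)] assms(3-6)] assms(7) by simp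

text \<open>The intersection of two balls is convex, hence connected, so the identity theorem
  carries agreement near one common point to the whole overlap.\<close>

lemma holomorphic_eq_on_ball_Int:
  assumes "f holomorphic_on ball a r" "g holomorphic_on ball b s"
    and "\<forall>\<^sub>F z in nhds c. f z = g z" "c \<in> ball a r" "c \<in> ball b s"
    and "z \<in> ball a r" "z \<in> ball b s"
  shows "f z = g z"
proof -
  have "\<forall>\<^sub>F z in nhds c. z \<in> ball a r \<inter> ball b s"
    using assms by (intro eventually_nhds_in_open) auto
  with assms(3) have "\<forall>\<^sub>F z in nhds c. f z = g z \<and> z \<in> ball a r \<inter> ball b s"
    by (rule eventually_conj)
  then obtain U where U: "open U" "c \<in> U" "\<And>z. z \<in> U \<Longrightarrow> f z = g z \<and> z \<in> ball a r \<inter> ball b s"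
    unfolding eventually_nhds by blast
  show ?thesis
  proof (rule analytic_continuation_open[of U "ball a r \<inter> ball b s" f g])
    show "connected (ball a r \<inter> ball b s)"
      by (intro convex_connected convex_Int convex_ball)
    show "f holomorphic_on ball a r \<inter> ball b s" "g holomorphic_on ball a r \<inter> ball b s"
      using assms holomorphic_on_subset by blast+
  qed (use U assms in auto)
qed

text \<open>Two of the balls around the circle that meet already meet inside the disc, because the
  nearest-point projection onto the disc decreases distances to its points. Hence the local
  extensions agree and glue.\<close>

lemma holomorphic_extend_beyond_circle:
  fixes f :: "complex \<Rightarrow> complex"
  assumes f: "f holomorphic_on ball c \<rho>" and "\<rho> > 0"
    and ext: "\<And>z. dist c z = \<rho> \<Longrightarrow>
      \<exists>e>0. \<exists>g. g holomorphic_on ball z e \<and> (\<forall>w\<in>ball z e \<inter> ball c \<rho>. g w = f w)"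
  shows "\<exists>\<rho>'>\<rho>. \<exists>h. h holomorphic_on ball c \<rho>' \<and> (\<forall>w\<in>ball c \<rho>. h w = f w)"
proof -
  have "\<exists>eg. fst eg > 0 \<and> snd eg holomorphic_on ball z (fst eg) \<and>
      (\<forall>w\<in>ball z (fst eg) \<inter> ball c \<rho>. snd eg w = f w)" if "z \<in> sphere c \<rho>" for z
    using ext[of z] that by auto
  then obtain eg where eg: "\<And>z. z \<in> sphere c \<rho> \<Longrightarrow> fst (eg z) > 0 \<and>
      snd (eg z) holomorphic_on ball z (fst (eg z)) \<and>
      (\<forall>w\<in>ball z (fst (eg z)) \<inter> ball c \<rho>. snd (eg z) w = f w)"
    by metis
  define e where "e z = fst (eg z)" for z
  define g where "g z = snd (eg z)" for z
  have e: "e z > 0" and g: "g z holomorphic_on ball z (e z)" if "z \<in> sphere c \<rho>" for z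
    using eg[OF that] by (auto simp: e_def g_def)
  have gf: "g z w = f w" if "z \<in> sphere c \<rho>" "w \<in> ball z (e z)" "w \<in> ball c \<rho>" for z w
    using eg[OF that(1)] that(2,3) unfolding e_def g_def by blast
  have agree: "g z w = g z' w"
    if z: "z \<in> sphere c \<rho>" "z' \<in> sphere c \<rho>" and w: "w \<in> ball z (e z)" "w \<in> ball z' (e z')" for z z' w
  proof (cases "w \<in> ball c \<rho>")
    case True
    then show ?thesis using gf[OF z(1) w(1)] gf[OF z(2) w(2)] by simp
  next
    case False
    define p where "p = closest_point (cball c \<rho>) w"
    have pc: "p \<in> cball c \<rho>"
      unfolding p_def using \<open>\<rho> > 0\<close> by (intro closest_point_in_set) auto
    have near: "p \<in> ball x (e x)" if "x \<in> sphere c \<rho>" "w \<in> ball x (e x)" for x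
    proof -
      have "closest_point (cball c \<rho>) x = x"
        using that by (intro closest_point_self) auto
      then have "dist p x \<le> dist w x"
        unfolding p_def using closest_point_lipschitz[of "cball c \<rho>" w x] \<open>\<rho> > 0\<close> by simp
      then show ?thesis using that by (auto simp: dist_commute)
    qed
    have "p \<in> closure (ball c \<rho>)"
      using pc \<open>\<rho> > 0\<close> by simp
    moreover have "p \<in> ball z (e z) \<inter> ball z' (e z')"
      using near[OF z(1) w(1)] near[OF z(2) w(2)] by simp
    ultimately have "ball c \<rho> \<inter> (ball z (e z) \<inter> ball z' (e z')) \<noteq> {}"
      using open_Int_closure_eq_empty[of "ball z (e z) \<inter> ball z' (e z')" "ball c \<rho>"]
      by (metis IntI Int_commute empty_iff open_Int open_ball)
    then obtain y where y: "y \<in> ball c \<rho>" "y \<in> ball z (e z) \<inter> ball z' (e z')"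
      by blast
    have "\<forall>\<^sub>F x in nhds y. x \<in> ball c \<rho> \<inter> (ball z (e z) \<inter> ball z' (e z'))"
      using y by (intro eventually_nhds_in_open) auto
    then have "\<forall>\<^sub>F x in nhds y. g z x = g z' x"
    proof eventually_elim
      case (elim x)
      then show ?case using gf[OF z(1), of x] gf[OF z(2), of x] by simp
    qed
    then show ?thesis
      using holomorphic_eq_on_ball_Int[OF g[OF z(1)] g[OF z(2)]] y w by blast
  qed
  define U where "U = ball c \<rho> \<union> (\<Union>z\<in>sphere c \<rho>. ball z (e z))"
  define h where "h w = (if w \<in> ball c \<rho> then f w else g (SOME z. z \<in> sphere c \<rho> \<and> w \<in> ball z (e z)) w)" for w
  have hg: "h w = g z w" if "z \<in> sphere c \<rho>" "w \<in> ball z (e z)" for z w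
  proof (cases "w \<in> ball c \<rho>")
    case True
    then show ?thesis using gf[OF that True] by (simp add: h_def)
  next
    case False
    let ?z = "SOME z. z \<in> sphere c \<rho> \<and> w \<in> ball z (e z)"
    have "?z \<in> sphere c \<rho> \<and> w \<in> ball ?z (e ?z)"
      by (rule someI[of "\<lambda>z. z \<in> sphere c \<rho> \<and> w \<in> ball z (e z)" z]) (use that in auto)
    then have "g ?z w = g z w"
      using agree that by blast
    then show ?thesis
      unfolding h_def using False by argo
  qed
  have hf: "h w = f w" if "w \<in> ball c \<rho>" for w
    using that by (simp add: h_def)
  have "h holomorphic_on U"
  proof -
    have "h holomorphic_on ball z (e z)" if "z \<in> sphere c \<rho>" for z
      using g[OF that] hg[OF that] by (metis holomorphic_transform)
    moreover have "h holomorphic_on ball c \<rho>"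
      using f hf by (metis holomorphic_transform)
    ultimately show ?thesis
      unfolding U_def by (intro holomorphic_on_Un holomorphic_on_UN_open open_UN) auto
  qed
  have "cball c \<rho> \<subseteq> U"
  proof
    fix z assume "z \<in> cball c \<rho>"
    then consider "z \<in> ball c \<rho>" | "z \<in> sphere c \<rho>"
      by fastforce
    then show "z \<in> U"
      unfolding U_def using e[of z] by cases (blast, force)
  qed
  moreover have "open U"
    unfolding U_def by auto
  ultimately obtain d where "d > 0" and d: "\<And>x y. x \<in> cball c \<rho> \<Longrightarrow> y \<in> - U \<Longrightarrow> d \<le> dist x y"
    using separate_compact_closed[of "cball c \<rho>" "- U"]
    by (metis Compl_disjoint2 compact_cball closed_Compl disjoint_eq_subset_Compl double_complement)
  have "ball c (\<rho> + d) \<subseteq> U"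
  proof
    fix w assume w: "w \<in> ball c (\<rho> + d)"
    show "w \<in> U"
    proof (cases "dist c w \<le> \<rho>")
      case True
      then show ?thesis using \<open>cball c \<rho> \<subseteq> U\<close> by auto
    next
      case False
      \<comment> \<open>The radial projection of w onto the circle. Its distance to w is
        \<open>dist c w - \<rho>\<close>, less than d, so w cannot lie outside U.\<close>
      define x where "x = c + (\<rho> / dist c w) *\<^sub>R (w - c)"
      have *: "dist c w > 0" using False \<open>\<rho> > 0\<close> by linarith
      have "dist c x = \<rho>"
        using * \<open>\<rho> > 0\<close> by (simp add: x_def dist_norm norm_minus_commute)
      moreover have "w - x = (1 - \<rho> / dist c w) *\<^sub>R (w - c)"
        by (simp add: x_def algebra_simps)
      then have "dist x w = \<bar>1 - \<rho> / dist c w\<bar> * dist c w"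
        by (metis dist_commute dist_norm norm_scaleR)
      then have "dist x w = dist c w - \<rho>"
        using * False by (simp add: left_diff_distrib)
      ultimately show ?thesis using w d[of x w] by auto
    qed
  qed
  then have "h holomorphic_on ball c (\<rho> + d)"
    using \<open>h holomorphic_on U\<close> holomorphic_on_subset by blast
  then show ?thesis using hf \<open>d > 0\<close> by (intro exI[of _ "\<rho> + d"]) auto
qed

subsection \<open>Branches of a continuable germ\<close>

lemma eval_fps_holomorphic_on_ball:
  assumes "ereal R \<le> fps_conv_radius \<phi>"
  shows "eval_fps (\<phi> :: complex fps) holomorphic_on ball 0 R"
proof (intro holomorphic_on_eval_fps subsetI)
  fix w assume "w \<in> ball (0::complex) R"
  then have "ereal (norm w) < ereal R" by simp
  then have "ereal (norm w) < fps_conv_radius \<phi>"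
    using assms by (rule less_le_trans)
  then show "w \<in> eball 0 (fps_conv_radius \<phi>)"
    by (simp add: in_eball_iff)
qed

text \<open>Replacing each \<open>F t\<close> by a function with the same germ at
  \<open>\<gamma> t\<close> is harmless: by continuity, \<open>\<gamma> s\<close> stays in the
  neighbourhood where \<open>F' t\<close> and \<open>F t\<close> agree as long as s is close to
  t.\<close>

lemma coherent_along_cong:
  assumes F: "coherent_along S \<gamma> F" and cont: "continuous_on S \<gamma>"
    and eq: "\<And>t. t \<in> S \<Longrightarrow> \<gamma>' t = \<gamma> t" "\<And>t. t \<in> S \<Longrightarrow> \<forall>\<^sub>F z in nhds (\<gamma> t). F' t z = F t z"
  shows "coherent_along S \<gamma>' F'"
  unfolding coherent_along_def
proof (intro conjI ballI)
  fix t assume t: "t \<in> S"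
  show "F' t analytic_on {\<gamma>' t}"
    using coherent_along_analytic[OF F t] analytic_at_cong[OF eq(2)[OF t]] eq(1)[OF t] by simp
  obtain U where U: "open U" "\<gamma> t \<in> U" "\<And>z. z \<in> U \<Longrightarrow> F' t z = F t z"
    using eq(2)[OF t] unfolding eventually_nhds by blast
  obtain e where e: "e > 0" "ball (\<gamma> t) e \<subseteq> U"
    using U(1,2) by (meson openE)
  obtain d where d: "d > 0" "\<And>s. s \<in> S \<Longrightarrow> dist s t < d \<Longrightarrow>
      \<gamma> s \<in> ball (\<gamma> t) e \<and> (\<forall>\<^sub>F z in nhds (\<gamma> s). F s z = F t z)"
    using coherent_along_nhd[OF F t cont e(1)] by metis
  have "\<forall>\<^sub>F z in nhds (\<gamma>' s). F' s z = F' t z" if s: "s \<in> S" "dist s t < d" for s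
  proof -
    have "\<forall>\<^sub>F z in nhds (\<gamma> s). z \<in> U"
      using d(2)[OF s] e(2) U(1) by (intro eventually_nhds_in_open) auto
    moreover have "\<forall>\<^sub>F z in nhds (\<gamma> s). F s z = F t z"
      using d(2)[OF s] by simp
    ultimately have "\<forall>\<^sub>F z in nhds (\<gamma> s). F' s z = F' t z"
      using eq(2)[OF s(1)] by eventually_elim (simp add: U(3))
    then show ?thesis using eq(1)[OF s(1)] by simp
  qed
  with d(1) show "\<exists>d>0. \<forall>s\<in>S. dist s t < d \<longrightarrow> (\<forall>\<^sub>F z in nhds (\<gamma>' s). F' s z = F' t z)"
    by blast
qed

text \<open>A point outside one of the closed sets has a neighbourhood that misses it, so there the
  condition for that set is vacuous.\<close>

lemma coherent_along_Un_closed: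
  assumes S: "coherent_along S \<gamma> F" "closed S" and T: "coherent_along T \<gamma> F" "closed T"
  shows "coherent_along (S \<union> T) \<gamma> F"
proof -
  have near: "\<exists>d>0. \<forall>s\<in>X. dist s t < d \<longrightarrow> (\<forall>\<^sub>F z in nhds (\<gamma> s). F s z = F t z)"
    if X: "coherent_along X \<gamma> F" "closed X" for X t
  proof (cases "t \<in> X")
    case True
    then show ?thesis using X(1) unfolding coherent_along_def by blast
  next
    case False
    then obtain d where d: "d > 0" "ball t d \<subseteq> - X"
      using X(2) open_contains_ball[of "- X"] by auto
    then have "\<not> dist s t < d" if "s \<in> X" for s
      using that d(2) by (auto simp: dist_commute subset_iff)
    with d(1) show ?thesis by blast
  qed
  show ?thesis
    unfolding coherent_along_def
  proof (intro conjI ballI)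
    show "F t analytic_on {\<gamma> t}" if "t \<in> S \<union> T" for t
      using that S(1) T(1) by (auto simp: coherent_along_def)
    fix t
    obtain d where d: "d > 0" "\<forall>s\<in>S. dist s t < d \<longrightarrow> (\<forall>\<^sub>F z in nhds (\<gamma> s). F s z = F t z)"
      using near[OF S] by blast
    obtain d' where d': "d' > 0" "\<forall>s\<in>T. dist s t < d' \<longrightarrow> (\<forall>\<^sub>F z in nhds (\<gamma> s). F s z = F t z)"
      using near[OF T] by blast
    show "\<exists>d>0. \<forall>s\<in>S \<union> T. dist s t < d \<longrightarrow> (\<forall>\<^sub>F z in nhds (\<gamma> s). F s z = F t z)"
    proof (intro exI[of _ "min d d'"] conjI ballI impI)
      show "\<forall>\<^sub>F z in nhds (\<gamma> s). F s z = F t z" if "s \<in> S \<union> T" "dist s t < min d d'" for s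
        using that d(2) d'(2) by auto
    qed (use d(1) d'(1) in simp)
  qed
qed

text \<open>The two closed halves of the interval share t = 1/2, where the pasted family takes
  \<open>F 1\<close> while the second half expects \<open>G 0\<close>; these have the same germ by
  assumption.\<close>

lemma coherent_along_join:
  assumes F: "coherent_along {0..1} p F" "path p" and G: "coherent_along {0..1} q G" "path q"
    and pq: "pathfinish p = pathstart q" "\<forall>\<^sub>F z in nhds (pathstart q). G 0 z = F 1 z"
  shows "coherent_along {0..1} (p +++ q) (\<lambda>t. if t \<le> 1/2 then F (2 * t) else G (2 * t - 1))"
proof -
  let ?E = "\<lambda>t. if t \<le> 1/2 then F (2 * t) else G (2 * t - 1)"
  have "coherent_along {0..1/2} (\<lambda>t. p (2 * t)) (\<lambda>t. F (2 * t))"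
    by (rule coherent_along_compose[OF F(1)]) (auto intro!: continuous_intros)
  moreover have "continuous_on {0..1/2} (\<lambda>t. p (2 * t))"
    by (rule continuous_on_compose2[OF F(2)[unfolded path_def]]) (auto intro!: continuous_intros)
  ultimately have 1: "coherent_along {0..1/2} (p +++ q) ?E"
    by (rule coherent_along_cong) (simp_all add: joinpaths_def)
  have "coherent_along {1/2..1} (\<lambda>t. q (2 * t - 1)) (\<lambda>t. G (2 * t - 1))"
    by (rule coherent_along_compose[OF G(1)]) (auto intro!: continuous_intros)
  moreover have "continuous_on {1/2..1} (\<lambda>t. q (2 * t - 1))"
    by (rule continuous_on_compose2[OF G(2)[unfolded path_def]]) (auto intro!: continuous_intros)
  ultimately have 2: "coherent_along {1/2..1} (p +++ q) ?E"
  proof (rule coherent_along_cong)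
    fix t :: real assume t: "t \<in> {1/2..1}"
    show "(p +++ q) t = q (2 * t - 1)"
    proof (cases "t = 1/2")
      case True
      then have "2 * t = 1" by simp
      then have "(p +++ q) t = p 1" "2 * t - 1 = 0"
        unfolding joinpaths_def by simp_all
      then show ?thesis
        using pq(1) by (simp only: pathfinish_def pathstart_def)
    next
      case False
      then show ?thesis using t by (simp add: joinpaths_def)
    qed
    show "\<forall>\<^sub>F z in nhds (q (2 * t - 1)). ?E t z = G (2 * t - 1) z"
    proof (cases "t = 1/2")
      case True
      have "\<forall>\<^sub>F z in nhds (q 0). F 1 z = G 0 z"
        using pq(2) unfolding pathstart_def by eventually_elim simp
      moreover have "2 * t = 1" using True by simp
      ultimately show ?thesis by simp
    next
      case False
      then show ?thesis using t by simp
    qed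
  qed
  have "{0..1/2} \<union> {1/2..1::real} = {0..1}" by auto
  then show ?thesis using coherent_along_Un_closed[OF 1 _ 2] by simp
qed

text \<open>A point of the Riemann surface of f: a germ at c reached along some path. Quantifying
  the path away lets one pass from branch to branch without carrying paths along.\<close>

definition branch_at ::
    "complex set \<Rightarrow> real \<Rightarrow> (complex \<Rightarrow> complex) \<Rightarrow> complex \<Rightarrow> (complex \<Rightarrow> complex) \<Rightarrow> bool" where
  "branch_at \<Omega> R f c g \<longleftrightarrow>
     (\<exists>p F. valid_path p \<and> path_image p \<subseteq> - \<Omega> \<and> pathstart p \<in> punctured_disc R \<and> pathfinish p = c \<and>
        continuation_along f p F \<and> (\<forall>\<^sub>F z in nhds c. F 1 z = g z))"

text \<open>The continuation clause of \<open>Omega_continuable\<close>, for a function instead of a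
  series and with the radius exposed so that it can be shrunk.\<close>

definition continuable_outside :: "complex set \<Rightarrow> real \<Rightarrow> (complex \<Rightarrow> complex) \<Rightarrow> bool" where
  "continuable_outside \<Omega> R f \<longleftrightarrow>
     (\<forall>\<gamma>. valid_path \<gamma> \<and> path_image \<gamma> \<subseteq> - \<Omega> \<and> pathstart \<gamma> \<in> punctured_disc R \<longrightarrow> continuable_along f \<gamma>)"

lemma branch_at_analytic:
  assumes "branch_at \<Omega> R f c g"
  shows "g analytic_on {c}"
proof -
  obtain p F where "pathfinish p = c" "continuation_along f p F" "\<forall>\<^sub>F z in nhds c. F 1 z = g z"
    using assms unfolding branch_at_def by blast
  moreover from this have "F 1 analytic_on {c}"
    using coherent_along_analytic[of "{0..1}" p F 1] by (simp add: continuation_along_iff pathfinish_def)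
  ultimately show ?thesis
    using analytic_at_cong[of "F 1" g c] by simp
qed

lemma branch_at_cong:
  assumes "branch_at \<Omega> R f c g" "\<forall>\<^sub>F z in nhds c. g z = h z"
  shows "branch_at \<Omega> R f c h"
proof -
  obtain p F where *: "valid_path p" "path_image p \<subseteq> - \<Omega>" "pathstart p \<in> punctured_disc R"
    "pathfinish p = c" "continuation_along f p F" "\<forall>\<^sub>F z in nhds c. F 1 z = g z"
    using assms(1) unfolding branch_at_def by blast
  have "\<forall>\<^sub>F z in nhds c. F 1 z = h z"
    using *(6) assms(2) by eventually_elim simp
  with * show ?thesis unfolding branch_at_def by blast
qed

lemma branch_at_start:
  assumes "c \<in> punctured_disc R" "c \<notin> \<Omega>" "f analytic_on {c}"
  shows "branch_at \<Omega> R f c f"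
proof -
  have "continuation_along f (linepath c c) (\<lambda>_. f)"
    unfolding continuation_along_iff using assms by (auto intro!: coherent_along_const)
  with assms show ?thesis
    unfolding branch_at_def by (intro exI[of _ "linepath c c"] exI[of _ "\<lambda>_. f"]) auto
qed

lemma branch_at_prolong:
  assumes "branch_at \<Omega> R f c g" and q: "valid_path q" "path_image q \<subseteq> - \<Omega>" "pathstart q = c"
    and G: "continuation_along g q G"
  shows "branch_at \<Omega> R f (pathfinish q) (G 1)"
proof -
  obtain p F where p: "valid_path p" "path_image p \<subseteq> - \<Omega>" "pathstart p \<in> punctured_disc R"
    "pathfinish p = c" and F: "continuation_along f p F" "\<forall>\<^sub>F z in nhds c. F 1 z = g z"
    using assms(1) unfolding branch_at_def by blast
  let ?E = "\<lambda>t. if t \<le> 1/2 then F (2 * t) else G (2 * t - 1)"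
  have "\<forall>\<^sub>F z in nhds c. G 0 z = g z"
    using G q(3) by (simp add: continuation_along_iff pathstart_def)
  with F(2) have "\<forall>\<^sub>F z in nhds c. G 0 z = F 1 z"
    by eventually_elim simp
  then have "coherent_along {0..1} (p +++ q) ?E"
    using F G p q by (intro coherent_along_join) (auto simp: continuation_along_iff valid_path_imp_path)
  moreover have "\<forall>\<^sub>F z in nhds ((p +++ q) 0). ?E 0 z = f z"
    using F(1) by (simp add: continuation_along_iff joinpaths_def)
  ultimately have "continuation_along f (p +++ q) ?E"
    by (simp add: continuation_along_iff)
  moreover have "valid_path (p +++ q)" "path_image (p +++ q) \<subseteq> - \<Omega>"
    using p q by (auto simp: path_image_join)
  ultimately show ?thesis
    unfolding branch_at_def using p q by (intro exI[of _ "p +++ q"] exI[of _ ?E]) auto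
qed

text \<open>Continue f along \<open>p +++ q\<close>. By uniqueness the first half ends in the germ
  g, hence the second half continues g along q.\<close>

lemma branch_at_continuable:
  assumes br: "branch_at \<Omega> R f c g" and f: "continuable_outside \<Omega> R f"
    and q: "valid_path q" "path_image q \<subseteq> - \<Omega>" "pathstart q = c"
  obtains G where "continuation_along g q G"
proof -
  obtain p F where p: "valid_path p" "path_image p \<subseteq> - \<Omega>" "pathstart p \<in> punctured_disc R"
    "pathfinish p = c" and F: "continuation_along f p F" "\<forall>\<^sub>F z in nhds c. F 1 z = g z"
    using br unfolding branch_at_def by blast
  have "valid_path (p +++ q)" "path_image (p +++ q) \<subseteq> - \<Omega>" "pathstart (p +++ q) \<in> punctured_disc R"
    using p q by (auto simp: path_image_join)
  then obtain E where E: "continuation_along f (p +++ q) E"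
    using f unfolding continuable_outside_def continuable_along_def by blast
  have cp: "continuous_on {0..1} p" and cq: "continuous_on {0..1} q"
    using p q by (auto dest: valid_path_imp_path simp: path_def)
  have pj: "(p +++ q) (t / 2) = p t" and qj: "(p +++ q) ((t + 1) / 2) = q t" if "t \<in> {0..1}" for t
    using that p(4) q(3) by (auto simp: joinpaths_def pathfinish_def pathstart_def field_simps)
  have Ec: "coherent_along {0..1} (p +++ q) E"
    using E by (simp add: continuation_along_iff)
  have E1: "coherent_along {0..1} (\<lambda>t. (p +++ q) (t / 2)) (\<lambda>t. E (t / 2))"
    by (rule coherent_along_compose[OF Ec]) (auto intro!: continuous_intros)
  have E1: "coherent_along {0..1} p (\<lambda>t. E (t / 2))"
    by (rule coherent_along_cong[OF E1]) (use continuous_on_eq[OF cp] pj in simp_all)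
  have E2: "coherent_along {0..1} (\<lambda>t. (p +++ q) ((t + 1) / 2)) (\<lambda>t. E ((t + 1) / 2))"
    by (rule coherent_along_compose[OF Ec]) (auto intro!: continuous_intros)
  have E2: "coherent_along {0..1} q (\<lambda>t. E ((t + 1) / 2))"
    by (rule coherent_along_cong[OF E2]) (use continuous_on_eq[OF cq] qj in simp_all)
  have "\<forall>\<^sub>F z in nhds (p 0). E (0 / 2) z = f z" "\<forall>\<^sub>F z in nhds (p 0). F 0 z = f z"
    using E F(1) pj[of 0] by (simp_all add: continuation_along_iff)
  then have "\<forall>\<^sub>F z in nhds (p 0). E (0 / 2) z = F 0 z"
    by eventually_elim simp
  then have "\<forall>\<^sub>F z in nhds (p 1). E (1 / 2) z = F 1 z"
    using coherent_along_unique[OF E1, of F 0 1] F(1) cp by (simp add: continuation_along_iff)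
  moreover have pq: "p 1 = c" "q 0 = c"
    using p(4) q(3) by (auto simp: pathfinish_def pathstart_def)
  ultimately have "\<forall>\<^sub>F z in nhds c. E (1 / 2) z = F 1 z"
    by simp
  with F(2) have "\<forall>\<^sub>F z in nhds c. E (1 / 2) z = g z"
    by eventually_elim simp
  then have "\<forall>\<^sub>F z in nhds (q 0). E ((0 + 1) / 2) z = g z"
    using pq by simp
  with E2 have "continuation_along g q (\<lambda>t. E ((t + 1) / 2))"
    by (simp add: continuation_along_iff)
  then show thesis by (rule that)
qed

text \<open>If the Taylor series at c had a radius of convergence r < d, continuing the germ along
  each radius would extend its sum across every point of the circle of radius r, hence to a larger
  disc, against the choice of r.\<close>

lemma branch_at_extends_to_ball:
  assumes br: "branch_at \<Omega> R f c g" and f: "continuable_outside \<Omega> R f"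
    and d: "ball c d \<inter> \<Omega> = {}"
  obtains h where "h holomorphic_on ball c d" "\<forall>\<^sub>F z in nhds c. h z = g z"
proof -
  define \<Phi> where "\<Phi> = fps_expansion g c"
  define h where "h z = eval_fps \<Phi> (z - c)" for z
  have *: "(\<lambda>x. g (c + x)) has_fps_expansion \<Phi>"
    unfolding \<Phi>_def by (intro analytic_at_imp_has_fps_expansion branch_at_analytic[OF br])
  then have pos: "fps_conv_radius \<Phi> > 0" and ev: "\<forall>\<^sub>F z in nhds 0. eval_fps \<Phi> z = g (c + z)"
    by (auto simp: has_fps_expansion_def)
  have hg: "\<forall>\<^sub>F z in nhds c. h z = g z"
    using ev unfolding h_def nhds_to_0[of c] eventually_filtermap by (simp add: add.commute)
  have hol: "h holomorphic_on ball c r" if "ereal r \<le> fps_conv_radius \<Phi>" for r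
    unfolding h_def[abs_def]
    by (rule holomorphic_on_compose_gen[unfolded o_def, of "\<lambda>z. z - c" _ "eval_fps \<Phi>" "ball 0 r"])
      (use eval_fps_holomorphic_on_ball[OF that] in \<open>auto intro!: holomorphic_intros simp: dist_norm norm_minus_commute\<close>)
  have "ereal d \<le> fps_conv_radius \<Phi>"
  proof (rule ccontr)
    assume "\<not> ?thesis"
    then have "fps_conv_radius \<Phi> < ereal d" by simp
    then obtain r where r: "fps_conv_radius \<Phi> = ereal r" "r > 0" "r < d"
      using pos by (cases "fps_conv_radius \<Phi>") auto
    have hr: "h holomorphic_on ball c r"
      using hol r(1) by simp
    have "\<exists>e>0. \<exists>k. k holomorphic_on ball z e \<and> (\<forall>w\<in>ball z e \<inter> ball c r. k w = h w)"
      if z: "dist c z = r" for z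
    proof -
      have "path_image (linepath c z) \<subseteq> ball c d"
        using z r by (simp add: closed_segment_subset)
      then have "path_image (linepath c z) \<subseteq> - \<Omega>"
        using d by blast
      then obtain G where G: "continuation_along g (linepath c z) G"
        using branch_at_continuable[OF br f] by (metis pathstart_linepath valid_path_linepath)
      then have Gc: "coherent_along {0..1} (linepath c z) G"
        and G0: "\<forall>\<^sub>F w in nhds c. G 0 w = g w"
        by (auto simp: continuation_along_iff linepath_def)
      obtain e where e: "e > 0" "G 1 holomorphic_on ball z e"
        using coherent_along_analytic[OF Gc, of 1] unfolding analytic_on_def by (auto simp: linepath_def)
      obtain t where t: "t > 0" "\<And>s. s \<in> {0..1} \<Longrightarrow> dist s 1 < t \<Longrightarrow>
          linepath c z s \<in> ball z e \<and> (\<forall>\<^sub>F w in nhds (linepath c z s). G s w = G 1 w)"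
        using coherent_along_nhd[OF Gc _ continuous_on_linepath e(1), of 1]
        by (auto simp: linepath_1')
      \<comment> \<open>Strictly before the end of the radius, so that the point lies inside the
        disc, but late enough to be in the ball where \<open>G 1\<close> is holomorphic and to have
        the germ of \<open>G 1\<close>.\<close>
      define s where "s = max 0 (1 - t / 2)"
      have s: "s \<in> {0..<1}" "dist s 1 < t"
        using t(1) by (auto simp: s_def dist_real_def)
      have inr: "linepath c z u \<in> ball c r" if "u \<in> {0..<1}" for u
      proof -
        have "linepath c z u - c = u *\<^sub>R (z - c)"
          by (simp add: linepath_def algebra_simps)
        then have "dist c (linepath c z u) = u * r"
          using that z by (simp add: dist_norm norm_minus_commute[of c])
        then show ?thesis using that r(2) by simp
      qed
      have "coherent_along {0..<1} (linepath c z) (\<lambda>_. h)"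
        using hr inr by (intro coherent_along_const) (meson analytic_at open_ball)
      moreover have "coherent_along {0..<1} (linepath c z) G"
        by (rule coherent_along_subset[OF Gc]) auto
      moreover have "\<forall>\<^sub>F w in nhds c. h w = G 0 w"
        using hg G0 by eventually_elim simp
      then have "\<forall>\<^sub>F w in nhds (linepath c z 0). h w = G 0 w"
        by (simp add: linepath_def)
      ultimately have "\<forall>\<^sub>F w in nhds (linepath c z s). h w = G s w"
        using s(1) by (intro coherent_along_unique[of "{0..<1}" "linepath c z" "\<lambda>_. h" G 0 s])
          (auto intro!: continuous_intros)
      moreover have near: "linepath c z s \<in> ball z e" "\<forall>\<^sub>F w in nhds (linepath c z s). G s w = G 1 w"
        using t(2)[of s] s by auto
      ultimately have "\<forall>\<^sub>F w in nhds (linepath c z s). G 1 w = h w"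
        using eventually_elim2[of "\<lambda>w. h w = G s w" _ "\<lambda>w. G s w = G 1 w"] by fastforce
      then have "G 1 w = h w" if "w \<in> ball z e \<inter> ball c r" for w
        using holomorphic_eq_on_ball_Int[OF e(2) hr _ near(1) inr[OF s(1)]] that by blast
      then show ?thesis using e by blast
    qed
    then obtain r' k where k: "r' > r" "k holomorphic_on ball c r'" "\<forall>w\<in>ball c r. k w = h w"
      using holomorphic_extend_beyond_circle[OF hr r(2)] by blast
    \<comment> \<open>The extension k has the germ g at c, so its Taylor series is again \<Phi>;
      being holomorphic on the larger disc, it forces a radius of convergence of at least
      r'.\<close>
    have "\<forall>\<^sub>F w in nhds c. w \<in> ball c r"
      using r(2) by (intro eventually_nhds_in_open) auto
    with hg have "\<forall>\<^sub>F w in nhds c. k w = g w"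
      by eventually_elim (use k(3) in auto)
    then have "fps_expansion k c = \<Phi>"
      unfolding \<Phi>_def by (rule fps_expansion_cong)
    moreover have "ereal r' \<le> fps_conv_radius (fps_expansion k c)"
      using k(2) by (intro conv_radius_fps_expansion) simp
    ultimately show False using r(1) k(1) by simp
  qed
  then show thesis using that hol hg by blast
qed

lemma branch_at_transport:
  assumes br: "branch_at \<Omega> R f c g" and g: "g holomorphic_on ball c d"
    and d: "ball c d \<inter> \<Omega> = {}" and z: "z \<in> ball c d"
  shows "branch_at \<Omega> R f z g"
proof -
  have "c \<in> ball c d"
    using z by (auto intro: le_less_trans[OF zero_le_dist])
  then have im: "path_image (linepath c z) \<subseteq> ball c d"
    using z convex_ball[of c d] by (simp add: closed_segment_subset)
  have "continuation_along g (linepath c z) (\<lambda>_. g)"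
    unfolding continuation_along_iff
  proof
    show "coherent_along {0..1} (linepath c z) (\<lambda>_. g)"
    proof (rule coherent_along_const)
      fix t :: real assume "t \<in> {0..1}"
      then have "linepath c z t \<in> ball c d"
        using im unfolding path_image_def by blast
      then show "g analytic_on {linepath c z t}"
        using g by (meson analytic_at open_ball)
    qed
  qed simp
  from branch_at_prolong[OF br _ _ _ this] show ?thesis
    using im d by auto
qed

text \<open>Continuation along the points \<open>v k\<close> with a function on a whole ball at each
  of them. Being a branch of f is carried through the recursion, since this is what makes the next
  germ extend to its ball.\<close>

lemma branch_chain:
  assumes f: "continuable_outside \<Omega> R f" "f analytic_on {v 0}" "v 0 \<in> punctured_disc R"
    and v: "\<And>k. ball (v k) \<rho> \<inter> \<Omega> = {}" "\<And>k. dist (v k) (v (Suc k)) < \<rho>"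
  obtains F where "\<And>k. F k holomorphic_on ball (v k) \<rho>"
    "\<And>k z. z \<in> ball (v k) \<rho> \<Longrightarrow> z \<in> ball (v (Suc k)) \<rho> \<Longrightarrow> F (Suc k) z = F k z"
    "\<forall>\<^sub>F z in nhds (v 0). F 0 z = f z"
proof -
  have "\<rho> > 0" using v(2)[of 0] by (meson le_less_trans zero_le_dist)
  let ?P = "\<lambda>k h. h holomorphic_on ball (v k) \<rho> \<and> branch_at \<Omega> R f (v k) h \<and>
              (k = 0 \<longrightarrow> (\<forall>\<^sub>F z in nhds (v 0). h z = f z))"
  let ?Q = "\<lambda>k h h'. \<forall>z\<in>ball (v k) \<rho> \<inter> ball (v (Suc k)) \<rho>. h' z = h z"
  have notin: "v k \<notin> \<Omega>" for k
    using v(1)[of k] \<open>\<rho> > 0\<close> by (meson centre_in_ball disjoint_iff)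
  have "\<exists>F. \<forall>k. ?P k (F k) \<and> ?Q k (F k) (F (Suc k))"
  proof (rule dependent_nat_choice)
    have br: "branch_at \<Omega> R f (v 0) f"
      using branch_at_start f notin by blast
    obtain h where h: "h holomorphic_on ball (v 0) \<rho>" "\<forall>\<^sub>F z in nhds (v 0). h z = f z"
      using branch_at_extends_to_ball[OF br f(1) v(1)] by blast
    then have "\<forall>\<^sub>F z in nhds (v 0). f z = h z"
      by (auto elim: eventually_mono)
    with h show "\<exists>h. ?P 0 h"
      using branch_at_cong[OF br] by blast
  next
    fix h k assume P: "?P k h"
    have br: "branch_at \<Omega> R f (v (Suc k)) h"
      by (rule branch_at_transport[of _ _ _ "v k" _ \<rho>]) (use P v in \<open>auto simp: dist_commute\<close>)
    obtain h' where h': "h' holomorphic_on ball (v (Suc k)) \<rho>" "\<forall>\<^sub>F z in nhds (v (Suc k)). h' z = h z"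
      using branch_at_extends_to_ball[OF br f(1) v(1)] by blast
    then have "\<forall>\<^sub>F z in nhds (v (Suc k)). h z = h' z"
      by (auto elim: eventually_mono)
    then have "?P (Suc k) h'"
      using branch_at_cong[OF br] h'(1) by blast
    moreover have "?Q k h h'"
      using holomorphic_eq_on_ball_Int[OF h'(1) conjunct1[OF P] h'(2)] v(2)[of k] \<open>\<rho> > 0\<close>
      by (auto simp: dist_commute)
    ultimately show "\<exists>h'. ?P (Suc k) h' \<and> ?Q k h h'" by blast
  qed
  then obtain F where F: "\<And>k. ?P k (F k)" "\<And>k. ?Q k (F k) (F (Suc k))" by blast
  show thesis
  proof (rule that)
    show "F k holomorphic_on ball (v k) \<rho>" for k using F(1) by simp
    show "F (Suc k) z = F k z" if "z \<in> ball (v k) \<rho>" "z \<in> ball (v (Suc k)) \<rho>" for k z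
      using F(2)[of k] that by simp
    show "\<forall>\<^sub>F z in nhds (v 0). F 0 z = f z" using F(1)[of 0] by simp
  qed
qed

subsection \<open>Convolution over symmetric polygonal paths\<close>

text \<open>Cauchy's theorem in the form used for quadrilaterals and telescoping sums: one function
  P serves all segments of the convex domain.\<close>

lemma holomorphic_convex_linepath_primitive:
  assumes "f holomorphic_on S" "convex S" "open S"
  obtains P where "\<And>a b. a \<in> S \<Longrightarrow> b \<in> S \<Longrightarrow> contour_integral (linepath a b) f = P b - P a"
proof -
  obtain P where P: "\<And>x. x \<in> S \<Longrightarrow> (P has_field_derivative f x) (at x within S)"
    using holomorphic_convex_primitive'[OF assms(2,3,1)] by metis
  have "contour_integral (linepath a b) f = P b - P a" if "a \<in> S" "b \<in> S" for a b
  proof -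
    have "path_image (linepath a b) \<subseteq> S"
      using that assms(2) by (simp add: closed_segment_subset)
    from contour_integral_primitive[OF P valid_path_linepath this] show ?thesis
      by (simp add: contour_integral_unique)
  qed
  then show thesis by (rule that)
qed

text \<open>Differentiation under the integral sign. The end point \<open>b + \<kappa> * z\<close>
  covers two kinds of segment: \<kappa> = 0 gives a fixed one, b = 0 and \<kappa> = 1 the one that
  ends at z.\<close>

lemma holomorphic_on_segment_convolution:
  fixes a b \<kappa> :: complex
  assumes f: "f holomorphic_on A" "open A" and g: "g holomorphic_on B" "open B"
    and U: "convex U"
    and A: "\<And>z t. z \<in> U \<Longrightarrow> t \<in> {0..1} \<Longrightarrow> linepath a (b + \<kappa> * z) t \<in> A"
    and B: "\<And>z t. z \<in> U \<Longrightarrow> t \<in> {0..1} \<Longrightarrow> z - linepath a (b + \<kappa> * z) t \<in> B"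
  shows "(\<lambda>z. contour_integral (linepath a (b + \<kappa> * z)) (\<lambda>\<xi>. f \<xi> * g (z - \<xi>))) holomorphic_on U"
proof -
  define u where "u z t = linepath a (b + \<kappa> * z) t" for z t
  let ?F = "\<lambda>z t. f (u z t) * g (z - u z t) * (b + \<kappa> * z - a)"
  let ?F' = "\<lambda>z t. (deriv f (u z t) * (of_real t * \<kappa>) * g (z - u z t)
      + f (u z t) * (deriv g (z - u z t) * (1 - of_real t * \<kappa>))) * (b + \<kappa> * z - a)
      + f (u z t) * g (z - u z t) * \<kappa>"
  have cu: "continuous_on (U \<times> cbox 0 1) (\<lambda>x. u (fst x) (snd x))"
    unfolding u_def linepath_def by (intro continuous_intros)
  have c1: "continuous_on (U \<times> cbox 0 1) (\<lambda>x. h (u (fst x) (snd x)))" if "continuous_on A h" for h :: "complex \<Rightarrow> complex"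
    by (rule continuous_on_compose2[OF that cu]) (use A in \<open>auto simp: u_def\<close>)
  have c2: "continuous_on (U \<times> cbox 0 1) (\<lambda>x. h (fst x - u (fst x) (snd x)))" if "continuous_on B h" for h :: "complex \<Rightarrow> complex"
    by (rule continuous_on_compose2[OF that]) (use B in \<open>auto simp: u_def intro!: continuous_intros cu[simplified u_def cbox_interval]\<close>)
  have hol: "continuous_on A f" "continuous_on A (deriv f)" "continuous_on B g" "continuous_on B (deriv g)"
    using f g by (auto intro!: holomorphic_on_imp_continuous_on holomorphic_deriv)
  have du: "((\<lambda>z. u z t) has_field_derivative of_real t * \<kappa>) (at z within U)" for z t
    unfolding u_def linepath_def scaleR_conv_of_real by (auto intro!: derivative_eq_intros)
  have "(\<lambda>z. integral (cbox 0 1) (?F z)) holomorphic_on U"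
  proof (rule leibniz_rule_holomorphic[of U 0 1 ?F ?F'])
    fix z t assume z: "z \<in> U" and t: "t \<in> cbox 0 (1::real)"
    have "(f has_field_derivative deriv f (u z t)) (at (u z t))"
      using holomorphic_derivI[OF f] A[OF z] t by (auto simp: u_def)
    from DERIV_chain2[OF this du]
    have 1: "((\<lambda>z. f (u z t)) has_field_derivative deriv f (u z t) * (of_real t * \<kappa>)) (at z within U)" .
    have "(g has_field_derivative deriv g (z - u z t)) (at (z - u z t))"
      using holomorphic_derivI[OF g] B[OF z] t by (auto simp: u_def)
    from DERIV_chain2[OF this DERIV_diff[OF DERIV_ident du]]
    have 2: "((\<lambda>z. g (z - u z t)) has_field_derivative deriv g (z - u z t) * (1 - of_real t * \<kappa>)) (at z within U)" .
    show "((\<lambda>z. ?F z t) has_field_derivative ?F' z t) (at z within U)"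
      by (auto intro!: derivative_eq_intros 1 2 simp: algebra_simps)
  next
    fix z assume z: "z \<in> U"
    have "continuous_on (cbox 0 1) (\<lambda>t. (z, t))" "(\<lambda>t. (z, t)) ` cbox 0 1 \<subseteq> U \<times> cbox 0 1"
      using z by (auto intro: continuous_intros)
    from continuous_on_compose2[OF c1[OF hol(1)] this] continuous_on_compose2[OF c2[OF hol(3)] this]
    have "continuous_on (cbox 0 1) (\<lambda>t. f (u z t))" "continuous_on (cbox 0 1) (\<lambda>t. g (z - u z t))"
      by simp_all
    then show "?F z integrable_on cbox 0 1"
      by (intro integrable_continuous continuous_intros)
  next
    show "continuous_on (U \<times> cbox 0 1) (\<lambda>(z, t). ?F' z t)"
      unfolding case_prod_unfold
      by (intro continuous_intros c1 c2 hol)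
  qed (fact U)
  moreover have "integral (cbox 0 1) (?F z) = contour_integral (linepath a (b + \<kappa> * z)) (\<lambda>\<xi>. f \<xi> * g (z - \<xi>))" for z
    by (simp add: contour_integral_integral u_def)
  ultimately show ?thesis by simp
qed

lemma segment_dist_le:
  fixes a b x :: complex
  assumes "x \<in> closed_segment a b" "dist a b \<le> r"
  shows "dist a x \<le> r"
  using segment_bound(1)[OF assms(1)] assms(2) by (simp add: dist_norm norm_minus_commute)

text \<open>The index k numbers the polygonal paths, j the vertices along one of them.
  \<open>mesh\<close> concerns k \<le> K because a common N is available for finitely many paths.
  The bounds \<rho> / 8 keep the corners of each small quadrilateral in one disc of radius \<rho> /
  2.\<close>

locale path_grid =
  fixes v :: "nat \<Rightarrow> nat \<Rightarrow> complex" and N K :: nat and \<rho> :: real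
  assumes rho_pos: "\<rho> > 0"
    and start: "v k 0 = 0"
    and sym: "j \<le> N \<Longrightarrow> v k j + v k (N - j) = v k N"
    and mesh: "k \<le> K \<Longrightarrow> j < N \<Longrightarrow> dist (v k j) (v k (Suc j)) \<le> \<rho> / 8"
    and step: "j \<le> N \<Longrightarrow> dist (v k j) (v (Suc k) j) \<le> \<rho> / 8"
begin

text \<open>Each column j is a chain of discs continuing \<phi>. Compatibility of neighbouring
  columns is a consequence, proved in \<open>branch_grid_adjacent\<close>.\<close>

definition branch_grid :: "(complex \<Rightarrow> complex) \<Rightarrow> (nat \<Rightarrow> nat \<Rightarrow> complex \<Rightarrow> complex) \<Rightarrow> bool" where
  "branch_grid \<phi> f \<longleftrightarrow>
     (\<forall>j\<le>N. \<forall>z\<in>ball (v 0 j) \<rho>. f 0 j z = \<phi> z) \<and>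
     (\<forall>k. \<forall>j\<le>N. f k j holomorphic_on ball (v k j) \<rho> \<and>
        (\<forall>z\<in>ball (v k j) \<rho> \<inter> ball (v (Suc k) j) \<rho>. f (Suc k) j z = f k j z))"

lemma branch_grid_holomorphic:
  "branch_grid \<phi> f \<Longrightarrow> j \<le> N \<Longrightarrow> f k j holomorphic_on ball (v k j) \<rho>"
  by (simp add: branch_grid_def)

lemma branch_grid_start:
  "branch_grid \<phi> f \<Longrightarrow> j \<le> N \<Longrightarrow> dist (v 0 j) z < \<rho> \<Longrightarrow> f 0 j z = \<phi> z"
  by (simp add: branch_grid_def)

lemma branch_grid_step:
  "branch_grid \<phi> f \<Longrightarrow> j \<le> N \<Longrightarrow> dist (v k j) z < \<rho> \<Longrightarrow> dist (v (Suc k) j) z < \<rho> \<Longrightarrow> f (Suc k) j z = f k j z"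
  by (simp add: branch_grid_def)

text \<open>In row 0 both functions are \<phi>. From one row to the next, the four discs involved
  have \<open>v (Suc k) j\<close> in common, so agreement passes to the new row near that point, and
  by the identity theorem to the whole overlap.\<close>

lemma branch_grid_adjacent:
  assumes f: "branch_grid \<phi> f" and "k \<le> K" "j < N"
    and "dist (v k j) z < \<rho>" "dist (v k (Suc j)) z < \<rho>"
  shows "f k j z = f k (Suc j) z"
  using assms(2-5)
proof (induction k arbitrary: z)
  case 0
  then show ?case using branch_grid_start[OF f] by simp
next
  case (Suc k)
  define c where "c = v (Suc k) j"
  have d: "dist (v k j) c < \<rho>" "dist (v (Suc k) j) c < \<rho>" "dist (v (Suc k) (Suc j)) c < \<rho>"
    "dist (v k (Suc j)) c < \<rho>"
    using mesh[of "Suc k" j] step[of j k] step[of "Suc j" k] Suc.prems(1,2) rho_pos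
      dist_triangle[of "v k (Suc j)" "v (Suc k) j" "v (Suc k) (Suc j)"]
    by (auto simp: c_def dist_commute)
  have "\<forall>\<^sub>F w in nhds c. w \<in> ball (v k j) \<rho> \<inter> ball (v (Suc k) j) \<rho> \<inter>
      ball (v (Suc k) (Suc j)) \<rho> \<inter> ball (v k (Suc j)) \<rho>"
    using d by (intro eventually_nhds_in_open) auto
  then have "\<forall>\<^sub>F w in nhds c. f (Suc k) j w = f (Suc k) (Suc j) w"
  proof eventually_elim
    case (elim w)
    then show ?case
      using branch_grid_step[OF f, of j k w] branch_grid_step[OF f, of "Suc j" k w] Suc.IH[of w]
        Suc.prems(1,2) by auto
  qed
  then show ?case
    using d Suc.prems
    by (intro holomorphic_eq_on_ball_Int[OF branch_grid_holomorphic[OF f] branch_grid_holomorphic[OF f],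
          of j "Suc j" "Suc k" "Suc k" c z]) auto
qed

text \<open>Since \<open>v k j\<close> and \<open>v k (N - j)\<close> add up to
  \<open>v k N\<close>, the reflected point \<open>z - \<xi>\<close> misses
  \<open>v k (N - j)\<close> by at most the errors of z and \<xi> together.\<close>

lemma reflect_in_ball:
  assumes "j \<le> N" "dist (v k N) z < a" "dist (v k j) \<xi> \<le> b" "a + b \<le> \<rho>"
  shows "dist (v k (N - j)) (z - \<xi>) < \<rho>"
proof -
  have "v k (N - j) - (z - \<xi>) = (v k N - z) - (v k j - \<xi>)"
    using sym[OF assms(1), of k] by (simp add: algebra_simps)
  then have "dist (v k (N - j)) (z - \<xi>) \<le> dist (v k N) z + dist (v k j) \<xi>"
    by (metis dist_norm norm_triangle_ineq4)
  with assms show ?thesis by linarith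
qed

text \<open>The convolution integral over the polygonal path \<open>v k 0, \<dots>, v k N\<close>, prolonged by a segment to \<open>z\<close>.
  By symmetry of the path, \<open>z - \<xi>\<close> is close to \<open>v k (N - j)\<close> when \<open>\<xi>\<close> is close to \<open>v k j\<close>.\<close>

definition conv :: "(nat \<Rightarrow> nat \<Rightarrow> complex \<Rightarrow> complex) \<Rightarrow> (nat \<Rightarrow> nat \<Rightarrow> complex \<Rightarrow> complex) \<Rightarrow>
    nat \<Rightarrow> complex \<Rightarrow> complex" where
  "conv f g k z =
     (\<Sum>j<N. contour_integral (linepath (v k j) (v k (Suc j))) (\<lambda>\<xi>. f k j \<xi> * g k (N - j) (z - \<xi>))) +
     contour_integral (linepath (v k N) z) (\<lambda>\<xi>. f k N \<xi> * g k 0 (z - \<xi>))"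

text \<open>With z within \<rho> / 2 of the end vertex and \<xi> at most \<rho> / 2 from its vertex,
  \<open>z - \<xi>\<close> stays in the disc of radius \<rho> around the mirror vertex. The segment
  to z can be nearly that long, which dictates the radius.\<close>

lemma conv_holomorphic:
  assumes f: "branch_grid \<phi> f" and g: "branch_grid \<psi> g" and "k \<le> K"
  shows "conv f g k holomorphic_on ball (v k N) (\<rho> / 2)"
proof -
  let ?U = "ball (v k N) (\<rho> / 2)"
  have 1: "(\<lambda>z. contour_integral (linepath (v k j) (v k (Suc j))) (\<lambda>\<xi>. f k j \<xi> * g k (N - j) (z - \<xi>)))
      holomorphic_on ?U" if j: "j < N" for j
  proof -
    have near: "dist (v k j) (linepath (v k j) (v k (Suc j)) t) \<le> \<rho> / 8" if "t \<in> {0..1}" for t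
      using segment_dist_le[of _ "v k j" "v k (Suc j)" "\<rho> / 8"] mesh[OF \<open>k \<le> K\<close> j] that
      by (metis linepath_in_path)
    have "(\<lambda>z. contour_integral (linepath (v k j) (v k (Suc j) + 0 * z)) (\<lambda>\<xi>. f k j \<xi> * g k (N - j) (z - \<xi>)))
      holomorphic_on ?U"
    proof (rule holomorphic_on_segment_convolution[OF branch_grid_holomorphic[OF f] _ branch_grid_holomorphic[OF g]])
      fix z :: complex and t :: real assume z: "z \<in> ?U" and t: "t \<in> {0..1}"
      show "linepath (v k j) (v k (Suc j) + 0 * z) t \<in> ball (v k j) \<rho>"
        using near[OF t] rho_pos by simp
      show "z - linepath (v k j) (v k (Suc j) + 0 * z) t \<in> ball (v k (N - j)) \<rho>"
        using reflect_in_ball[of j k z "\<rho> / 2" _ "\<rho> / 8"] near[OF t] j z rho_pos by simp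
    qed (use j in auto)
    then show ?thesis by simp
  qed
  have "(\<lambda>z. contour_integral (linepath (v k N) (0 + 1 * z)) (\<lambda>\<xi>. f k N \<xi> * g k 0 (z - \<xi>)))
      holomorphic_on ?U"
  proof (rule holomorphic_on_segment_convolution[OF branch_grid_holomorphic[OF f] _ branch_grid_holomorphic[OF g]])
    fix z :: complex and t :: real assume z: "z \<in> ?U" and t: "t \<in> {0..1}"
    have *: "dist (v k N) (linepath (v k N) z t) \<le> \<rho> / 2"
      using segment_dist_le[of "linepath (v k N) z t" "v k N" z "\<rho> / 2"] linepath_in_path[OF t] z by auto
    then show "linepath (v k N) (0 + 1 * z) t \<in> ball (v k N) \<rho>"
      using rho_pos by simp
    show "z - linepath (v k N) (0 + 1 * z) t \<in> ball (v k 0) \<rho>"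
      using reflect_in_ball[of N k z "\<rho> / 2" _ "\<rho> / 2"] * z by simp
  qed auto
  then show ?thesis
    unfolding conv_def[abs_def] by (intro holomorphic_on_add holomorphic_on_sum 1) auto
qed

text \<open>Cauchy's theorem in the quadrilateral between the j-th edges of paths k and k + 1: the
  two edges differ by the integrals E over the sides joining the paths. These telescope;
  \<open>E 0\<close> vanishes because all paths start at 0, and the final segments to z absorb
  \<open>E N\<close>.\<close>

lemma conv_step:
  assumes f: "branch_grid \<phi> f" and g: "branch_grid \<psi> g" and k: "k < K"
    and z: "dist (v k N) z < \<rho> / 2" "dist (v (Suc k) N) z < \<rho> / 2"
  shows "conv f g (Suc k) z = conv f g k z"
proof -
  define I where "I k j \<xi> = f k j \<xi> * g k (N - j) (z - \<xi>)" for k j \<xi>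
  define E where "E j = contour_integral (linepath (v k j) (v (Suc k) j)) (I k j)" for j
  \<comment> \<open>The disc has radius \<rho> / 2 because the other half of \<rho> is taken up by
    the distance of z from \<open>v k N\<close> in the reflected argument.\<close>
  have prim: "\<exists>P. \<forall>a\<in>ball (v k j) (\<rho> / 2). \<forall>b\<in>ball (v k j) (\<rho> / 2).
      contour_integral (linepath a b) (I k j) = P b - P a" if j: "j \<le> N" for j
  proof -
    have "(\<lambda>\<xi>. g k (N - j) (z - \<xi>)) holomorphic_on ball (v k j) (\<rho> / 2)"
    proof (rule holomorphic_on_compose_gen[unfolded o_def, of "\<lambda>\<xi>. z - \<xi>" _ "g k (N - j)" "ball (v k (N - j)) \<rho>"])
      show "g k (N - j) holomorphic_on ball (v k (N - j)) \<rho>"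
        by (rule branch_grid_holomorphic[OF g]) simp
      show "(\<lambda>\<xi>. z - \<xi>) ` ball (v k j) (\<rho> / 2) \<subseteq> ball (v k (N - j)) \<rho>"
        using reflect_in_ball[OF j z(1), of _ "\<rho> / 2"] by auto
    qed (auto intro: holomorphic_intros)
    moreover have "f k j holomorphic_on ball (v k j) (\<rho> / 2)"
      by (rule holomorphic_on_subset[OF branch_grid_holomorphic[OF f j]]) (use rho_pos in auto)
    ultimately have "I k j holomorphic_on ball (v k j) (\<rho> / 2)"
      unfolding I_def[abs_def] by (intro holomorphic_on_mult)
    then obtain P where "\<And>a b. a \<in> ball (v k j) (\<rho> / 2) \<Longrightarrow> b \<in> ball (v k j) (\<rho> / 2) \<Longrightarrow>
        contour_integral (linepath a b) (I k j) = P b - P a"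
      using holomorphic_convex_linepath_primitive[OF _ convex_ball open_ball] by blast
    then show ?thesis by blast
  qed
  have summand: "contour_integral (linepath (v (Suc k) j) (v (Suc k) (Suc j))) (I (Suc k) j) =
      contour_integral (linepath (v k j) (v k (Suc j))) (I k j) + (E (Suc j) - E j)" if j: "j < N" for j
  proof -
    have *: "v k j \<in> ball (v k j) (\<rho> / 2)" "v k (Suc j) \<in> ball (v k j) (\<rho> / 2)"
      "v (Suc k) j \<in> ball (v k j) (\<rho> / 2)" "v (Suc k) (Suc j) \<in> ball (v k j) (\<rho> / 2)"
      using rho_pos mesh[of k j] step[of j k] step[of "Suc j" k] j k
        dist_triangle[of "v k j" "v (Suc k) (Suc j)" "v k (Suc j)"] by auto
    obtain P where P: "\<And>a b. a \<in> ball (v k j) (\<rho> / 2) \<Longrightarrow> b \<in> ball (v k j) (\<rho> / 2) \<Longrightarrow>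
      contour_integral (linepath a b) (I k j) = P b - P a"
      using prim[of j] j by auto
    have 1: "contour_integral (linepath (v (Suc k) j) (v (Suc k) (Suc j))) (I (Suc k) j) =
        contour_integral (linepath (v (Suc k) j) (v (Suc k) (Suc j))) (I k j)"
    proof (rule contour_integral_eq)
      fix \<xi> assume "\<xi> \<in> path_image (linepath (v (Suc k) j) (v (Suc k) (Suc j)))"
      then have d: "dist (v (Suc k) j) \<xi> \<le> \<rho> / 8"
        using segment_dist_le[OF _ mesh[of "Suc k" j]] j k by simp
      then have d': "dist (v k j) \<xi> \<le> \<rho> / 4"
        using step[of j k] j dist_triangle[of "v k j" \<xi> "v (Suc k) j"] by auto
      have "f (Suc k) j \<xi> = f k j \<xi>"
        using d d' rho_pos j by (intro branch_grid_step[OF f]) auto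
      moreover have "g (Suc k) (N - j) (z - \<xi>) = g k (N - j) (z - \<xi>)"
        using j reflect_in_ball[OF _ z(1) d'] reflect_in_ball[OF _ z(2) d] rho_pos
        by (intro branch_grid_step[OF g]) auto
      ultimately show "I (Suc k) j \<xi> = I k j \<xi>" by (simp add: I_def)
    qed
    \<comment> \<open>The side at j + 1 is defined with the branches of column j + 1. Adjacency
      replaces them by those of column j; in the second factor, \<open>N - j\<close> is the
      successor of \<open>N - Suc j\<close>.\<close>
    have 2: "E (Suc j) = contour_integral (linepath (v k (Suc j)) (v (Suc k) (Suc j))) (I k j)"
      unfolding E_def
    proof (rule contour_integral_eq)
      fix \<xi> assume "\<xi> \<in> path_image (linepath (v k (Suc j)) (v (Suc k) (Suc j)))"
      then have d: "dist (v k (Suc j)) \<xi> \<le> \<rho> / 8"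
        using segment_dist_le[OF _ step[of "Suc j" k]] j by simp
      then have d': "dist (v k j) \<xi> \<le> \<rho> / 4"
        using mesh[of k j] j k dist_triangle[of "v k j" \<xi> "v k (Suc j)"] by auto
      have "f k j \<xi> = f k (Suc j) \<xi>"
        using d d' rho_pos j k by (intro branch_grid_adjacent[OF f]) auto
      moreover have "g k (N - Suc j) (z - \<xi>) = g k (Suc (N - Suc j)) (z - \<xi>)"
        using j k reflect_in_ball[OF _ z(1) d] reflect_in_ball[OF _ z(1) d'] rho_pos
        by (intro branch_grid_adjacent[OF g]) (auto simp: Suc_diff_Suc)
      ultimately show "I k (Suc j) \<xi> = I k j \<xi>"
        using j by (simp add: I_def Suc_diff_Suc)
    qed
    have 3: "E j = P (v (Suc k) j) - P (v k j)"
      unfolding E_def using P * by simp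
    show ?thesis
      unfolding 1 2 3 using P * by simp
  qed
  have last: "contour_integral (linepath (v (Suc k) N) z) (I (Suc k) N) =
      contour_integral (linepath (v k N) z) (I k N) - E N"
  proof -
    let ?B = "ball (v k N) (\<rho> / 2)"
    have *: "v k N \<in> ?B" "v (Suc k) N \<in> ?B" "z \<in> ?B"
      using rho_pos step[of N k] z by auto
    obtain P where P: "\<And>a b. a \<in> ?B \<Longrightarrow> b \<in> ?B \<Longrightarrow> contour_integral (linepath a b) (I k N) = P b - P a"
      using prim[of N] by auto
    have "contour_integral (linepath (v (Suc k) N) z) (I (Suc k) N) =
        contour_integral (linepath (v (Suc k) N) z) (I k N)"
    proof (rule contour_integral_eq)
      fix \<xi> assume \<xi>: "\<xi> \<in> path_image (linepath (v (Suc k) N) z)"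
      then have d: "dist (v (Suc k) N) \<xi> \<le> \<rho> / 2"
        using segment_dist_le[of \<xi> _ _ "\<rho> / 2"] z(2) by auto
      have "closed_segment (v (Suc k) N) z \<subseteq> ?B"
        using * by (intro closed_segment_subset) auto
      with \<xi> have d': "dist (v k N) \<xi> < \<rho> / 2" by auto
      have "f (Suc k) N \<xi> = f k N \<xi>"
        using d d' rho_pos by (intro branch_grid_step[OF f]) auto
      moreover have "g (Suc k) 0 (z - \<xi>) = g k 0 (z - \<xi>)"
        using reflect_in_ball[OF order.refl z(1) less_imp_le[OF d']] reflect_in_ball[OF order.refl z(2) d] rho_pos
        by (intro branch_grid_step[OF g]) auto
      ultimately show "I (Suc k) N \<xi> = I k N \<xi>" by (simp add: I_def)
    qed
    then show ?thesis using P * by (simp add: E_def)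
  qed
  have "E 0 = 0" by (simp add: E_def start)
  have conv_I: "conv f g k z = (\<Sum>j<N. contour_integral (linepath (v k j) (v k (Suc j))) (I k j)) +
      contour_integral (linepath (v k N) z) (I k N)" for k
    unfolding conv_def I_def[abs_def] by simp
  have "conv f g (Suc k) z = (\<Sum>j<N. contour_integral (linepath (v k j) (v k (Suc j))) (I k j) + (E (Suc j) - E j))
      + (contour_integral (linepath (v k N) z) (I k N) - E N)"
    using summand last by (simp add: conv_I)
  also have "\<dots> = conv f g k z"
    using \<open>E 0 = 0\<close> by (simp add: sum.distrib sum_lessThan_telescope conv_I)
  finally show ?thesis .
qed

text \<open>In row 0 all branches are \<phi> and \<psi> themselves, and the path is a subdivided
  straight segment followed by one to z. It may be replaced by the segment from 0 to z, since the
  integrand has a primitive on a convex set containing z and all vertices.\<close>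

lemma conv_start:
  assumes f: "branch_grid \<phi> f" and g: "branch_grid \<psi> g"
    and \<phi>: "\<phi> holomorphic_on ball 0 R" and \<psi>: "\<psi> holomorphic_on ball 0 R"
    and v0: "\<And>j. j \<le> N \<Longrightarrow> v 0 j = (real j / real N) *\<^sub>R v 0 N" and R: "norm (v 0 N) + \<rho> \<le> R"
    and z: "dist (v 0 N) z < \<rho> / 2"
  shows "conv f g 0 z = contour_integral (linepath 0 z) (\<lambda>\<xi>. \<phi> \<xi> * \<psi> (z - \<xi>))"
proof -
  let ?I = "\<lambda>\<xi>. \<phi> \<xi> * \<psi> (z - \<xi>)"
  let ?W = "ball 0 R \<inter> ball z R"
  have "(\<lambda>\<xi>. \<psi> (z - \<xi>)) holomorphic_on ?W"
    by (rule holomorphic_on_compose_gen[unfolded o_def, of "\<lambda>\<xi>. z - \<xi>" _ \<psi> "ball 0 R"])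
      (use \<psi> in \<open>auto intro!: holomorphic_intros simp: dist_norm norm_minus_commute\<close>)
  moreover have "\<phi> holomorphic_on ?W"
    by (rule holomorphic_on_subset[OF \<phi>]) auto
  ultimately have "?I holomorphic_on ?W"
    by (intro holomorphic_on_mult)
  then obtain P where P: "\<And>a b. a \<in> ?W \<Longrightarrow> b \<in> ?W \<Longrightarrow> contour_integral (linepath a b) ?I = P b - P a"
    using holomorphic_convex_linepath_primitive[of ?I ?W] by (auto intro: convex_Int)
  have nz: "norm z < R"
    using R z norm_triangle_ineq2[of z "v 0 N"] rho_pos by (simp add: dist_norm norm_minus_commute)
  have in_W: "v 0 j \<in> ?W" if j: "j \<le> N" for j
  proof -
    have le: "norm (v 0 i) \<le> norm (v 0 N)" if "i \<le> N" for i
    proof -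
      have "norm (v 0 i) = (real i / real N) * norm (v 0 N)"
        using v0[OF that] by (metis abs_of_nonneg divide_nonneg_nonneg norm_scaleR of_nat_0_le_iff)
      moreover have "(real i / real N) * norm (v 0 N) \<le> 1 * norm (v 0 N)"
        using that by (intro mult_right_mono) (auto simp: divide_simps)
      ultimately show ?thesis by simp
    qed
    \<comment> \<open>By symmetry, membership in \<open>ball z R\<close> reduces to the norm bound
      for the mirror vertex.\<close>
    have "z - v 0 j = v 0 (N - j) - (v 0 N - z)"
      using sym[OF j, of 0] by (simp add: algebra_simps)
    then have "norm (z - v 0 j) \<le> norm (v 0 (N - j)) + dist (v 0 N) z"
      by (metis dist_norm norm_triangle_ineq4)
    also have "\<dots> < R"
      using le[of "N - j"] z R rho_pos by auto
    finally have "norm (z - v 0 j) < R" .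
    then show ?thesis
      using le[OF j] R rho_pos by (auto simp: dist_norm)
  qed
  have z_W: "z \<in> ?W"
    using nz rho_pos R by (auto intro: le_less_trans[OF norm_ge_zero])
  have summand: "contour_integral (linepath (v 0 j) (v 0 (Suc j))) (\<lambda>\<xi>. f 0 j \<xi> * g 0 (N - j) (z - \<xi>)) =
      P (v 0 (Suc j)) - P (v 0 j)" if j: "j < N" for j
  proof -
    have "contour_integral (linepath (v 0 j) (v 0 (Suc j))) (\<lambda>\<xi>. f 0 j \<xi> * g 0 (N - j) (z - \<xi>)) =
        contour_integral (linepath (v 0 j) (v 0 (Suc j))) ?I"
    proof (rule contour_integral_eq)
      fix \<xi> assume "\<xi> \<in> path_image (linepath (v 0 j) (v 0 (Suc j)))"
      then have d: "dist (v 0 j) \<xi> \<le> \<rho> / 8"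
        using segment_dist_le[OF _ mesh[of 0 j]] j by simp
      show "f 0 j \<xi> * g 0 (N - j) (z - \<xi>) = ?I \<xi>"
        using branch_grid_start[OF f, of j \<xi>] branch_grid_start[OF g, of "N - j" "z - \<xi>"]
          reflect_in_ball[OF _ z d] d j rho_pos by simp
    qed
    also have "\<dots> = P (v 0 (Suc j)) - P (v 0 j)"
      using in_W j by (intro P) auto
    finally show ?thesis .
  qed
  have last: "contour_integral (linepath (v 0 N) z) (\<lambda>\<xi>. f 0 N \<xi> * g 0 0 (z - \<xi>)) = P z - P (v 0 N)"
  proof -
    have "contour_integral (linepath (v 0 N) z) (\<lambda>\<xi>. f 0 N \<xi> * g 0 0 (z - \<xi>)) =
        contour_integral (linepath (v 0 N) z) ?I"
    proof (rule contour_integral_eq)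
      fix \<xi> assume "\<xi> \<in> path_image (linepath (v 0 N) z)"
      then have d: "dist (v 0 N) \<xi> \<le> \<rho> / 2"
        using segment_dist_le[of \<xi> _ _ "\<rho> / 2"] z by auto
      show "f 0 N \<xi> * g 0 0 (z - \<xi>) = ?I \<xi>"
        using branch_grid_start[OF f, of N \<xi>] branch_grid_start[OF g, of 0 "z - \<xi>"]
          reflect_in_ball[OF _ z d] d rho_pos by simp
    qed
    also have "\<dots> = P z - P (v 0 N)"
      using in_W z_W by (intro P) auto
    finally show ?thesis .
  qed
  have "conv f g 0 z = (\<Sum>j<N. P (v 0 (Suc j)) - P (v 0 j)) + (P z - P (v 0 N))"
    using summand last by (simp add: conv_def)
  also have "\<dots> = P z - P 0"
    using sum_lessThan_telescope[of "\<lambda>j. P (v 0 j)" N] by (simp add: start)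
  also have "\<dots> = contour_integral (linepath 0 z) ?I"
    using P[of 0 z] in_W[of 0] z_W by (simp add: start)
  finally show ?thesis .
qed

end

subsection \<open>Symmetric deformation avoiding the singularities\<close>

text \<open>The weight a(s) that governs how far a point moves. What matters is that it is
  nonnegative, continuous in s for continuous h, and zero exactly when s \<le> \<sigma> or
  \<open>h s\<close> is within \<delta> of \<Omega>.\<close>

definition mobility :: "complex set \<Rightarrow> real \<Rightarrow> real \<Rightarrow> (real \<Rightarrow> complex) \<Rightarrow> real \<Rightarrow> real" where
  "mobility \<Omega> \<sigma> \<delta> h s = min (max 0 (s - \<sigma>)) (max 0 (infdist (h s) \<Omega> - \<delta>))"

text \<open>A discretised symmetric homotopy: the end point of \<open>deformed_path \<Omega> \<sigma> \<delta> c k\<close> is \<open>c k\<close>, points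
  near \<open>\<Omega>\<close> stay put in the next step, and their mirror images follow the end point. The factor
  \<open>s - \<sigma>\<close> of the mobility keeps a whole initial piece fixed; because of it the end point may pass
  through \<open>0\<close> when \<open>0 \<notin> \<Omega>\<close>.\<close>

primrec deformed_path ::
    "complex set \<Rightarrow> real \<Rightarrow> real \<Rightarrow> (nat \<Rightarrow> complex) \<Rightarrow> nat \<Rightarrow> real \<Rightarrow> complex" where
  "deformed_path \<Omega> \<sigma> \<delta> c 0 = (\<lambda>s. s *\<^sub>R c 0)"
| "deformed_path \<Omega> \<sigma> \<delta> c (Suc k) =
     (let h = deformed_path \<Omega> \<sigma> \<delta> c k; a = mobility \<Omega> \<sigma> \<delta> h
      in (\<lambda>s. h s + (a s / (a s + a (1 - s))) *\<^sub>R (c (Suc k) - c k)))"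

lemma mobility_nonneg: "0 \<le> mobility \<Omega> \<sigma> \<delta> h s"
  by (simp add: mobility_def)

text \<open>The margins are tuned to the freezing radius \<delta>. That a point and its mirror image
  are both frozen near \<Omega> is excluded by \<open>2 * \<delta> < d\<close>; that one is frozen
  near \<Omega> and the other near the start, by the bound involving \<open>norm (c 0)\<close>.
  Steps of at most \<delta> / 2 keep moving points at least \<delta> / 2 away from \<Omega>.\<close>

locale deformation =
  fixes \<Omega> :: "complex set" and \<sigma> \<delta> d :: real and c :: "nat \<Rightarrow> complex"
  assumes closed_Omega: "closed \<Omega>" "\<Omega> \<noteq> {}"
    and add_Omega: "\<omega> \<in> \<Omega> \<Longrightarrow> \<omega>' \<in> \<Omega> \<Longrightarrow> \<omega> + \<omega>' \<in> \<Omega>"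
    and sigma: "0 < \<sigma>" "\<sigma> < 1/2" and delta: "0 < \<delta>" "2 * \<delta> < d" "\<sigma> * norm (c 0) + \<delta> < d"
    and far: "d \<le> infdist (c k) \<Omega>"
    and short: "dist (c k) (c (Suc k)) \<le> \<delta> / 2"
    and far0: "\<sigma> \<le> s \<Longrightarrow> s \<le> 1 \<Longrightarrow> \<delta> / 2 \<le> infdist (s *\<^sub>R c 0) \<Omega>"
begin

abbreviation "H \<equiv> deformed_path \<Omega> \<sigma> \<delta> c"
abbreviation "a k \<equiv> mobility \<Omega> \<sigma> \<delta> (H k)"

lemma deformed_path_Suc:
  "H (Suc k) s = H k s + (a k s / (a k s + a k (1 - s))) *\<^sub>R (c (Suc k) - c k)"
  by (simp add: Let_def)

declare deformed_path.simps(2) [simp del]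

text \<open>Stated for a single k with the invariants as hypotheses, because their induction step
  relies on it. If both weights vanish, there are three possibilities: both points are near
  \<Omega>, and then \<open>c k\<close> is within \<open>2 * \<delta>\<close> of a sum of two points
  of \<Omega>; or one is in the fixed initial piece, and its mirror image near \<Omega> differs from
  \<open>c k\<close> by at most \<open>\<sigma> * norm (c 0)\<close>; or both are in the initial
  piece, against \<sigma> < 1/2. The first two contradict \<open>far\<close>.\<close>

lemma mobility_pos_aux:
  assumes sym: "\<And>s. 0 \<le> s \<Longrightarrow> s \<le> 1 \<Longrightarrow> H k s + H k (1 - s) = c k"
    and fixed: "\<And>s. 0 \<le> s \<Longrightarrow> s \<le> \<sigma> \<Longrightarrow> H k s = s *\<^sub>R c 0"
    and s: "0 \<le> s" "s \<le> 1"
  shows "a k s + a k (1 - s) > 0"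
proof (rule ccontr)
  assume "\<not> ?thesis"
  then have "a k s = 0" "a k (1 - s) = 0"
    using mobility_nonneg[of \<Omega> \<sigma> \<delta> "H k" s] mobility_nonneg[of \<Omega> \<sigma> \<delta> "H k" "1 - s"] by linarith+
  then have 1: "s \<le> \<sigma> \<or> infdist (H k s) \<Omega> \<le> \<delta>" and 2: "1 - s \<le> \<sigma> \<or> infdist (H k (1 - s)) \<Omega> \<le> \<delta>"
    by (auto simp: mobility_def min_def max_def split: if_splits)
  have mixed: False if u: "0 \<le> u" "u \<le> \<sigma>" "infdist (H k (1 - u)) \<Omega> \<le> \<delta>" for u
  proof -
    have "c k - H k (1 - u) = u *\<^sub>R c 0"
      using sym[of u] fixed[of u] u sigma by (simp add: algebra_simps)
    then have "dist (c k) (H k (1 - u)) = u * norm (c 0)"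
      using u by (simp add: dist_norm)
    also have "\<dots> \<le> \<sigma> * norm (c 0)"
      using u by (intro mult_right_mono) auto
    finally show False
      using infdist_triangle[of "c k" \<Omega> "H k (1 - u)"] u(3) far[of k] delta(3) by linarith
  qed
  from 1 2 consider "s \<le> \<sigma>" "1 - s \<le> \<sigma>" | "s \<le> \<sigma>" "infdist (H k (1 - s)) \<Omega> \<le> \<delta>"
    | "1 - s \<le> \<sigma>" "infdist (H k s) \<Omega> \<le> \<delta>"
    | "infdist (H k s) \<Omega> \<le> \<delta>" "infdist (H k (1 - s)) \<Omega> \<le> \<delta>"
    by blast
  then show False
  proof cases
    case 1
    then show ?thesis using sigma by linarith
  next
    case 2
    then show ?thesis using mixed[of s] s by simp
  next
    case 3
    then show ?thesis using mixed[of "1 - s"] s by simp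
  next
    case 4
    obtain \<omega> where \<omega>: "\<omega> \<in> \<Omega>" "infdist (H k s) \<Omega> = dist (H k s) \<omega>"
      using infdist_attains_inf[OF closed_Omega] by metis
    obtain \<omega>' where \<omega>': "\<omega>' \<in> \<Omega>" "infdist (H k (1 - s)) \<Omega> = dist (H k (1 - s)) \<omega>'"
      using infdist_attains_inf[OF closed_Omega] by metis
    have "d \<le> dist (c k) (\<omega> + \<omega>')"
      using far[of k] infdist_le[OF add_Omega[OF \<omega>(1) \<omega>'(1)], of "c k"] by linarith
    also have "\<dots> = dist (H k s + H k (1 - s)) (\<omega> + \<omega>')"
      using sym[OF s] by simp
    also have "\<dots> \<le> dist (H k s) \<omega> + dist (H k (1 - s)) \<omega>'"
      by (rule dist_triangle_add)
    also have "\<dots> \<le> 2 * \<delta>"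
      using 4 \<omega>(2) \<omega>'(2) by linarith
    finally show ?thesis using delta(2) by linarith
  qed
qed

text \<open>Both invariants go through one induction: together they make the denominator positive,
  and then the fractions for s and 1 - s add up to 1, so the pair moves by exactly the increment of
  c. For s \<le> \<sigma> the fraction is 0.\<close>

lemma deformed_path_invariants:
  shows deformed_path_sym: "0 \<le> s \<Longrightarrow> s \<le> 1 \<Longrightarrow> H k s + H k (1 - s) = c k"
    and deformed_path_fixed: "0 \<le> s \<Longrightarrow> s \<le> \<sigma> \<Longrightarrow> H k s = s *\<^sub>R c 0"
proof -
  have "(\<forall>s\<in>{0..1}. H k s + H k (1 - s) = c k) \<and> (\<forall>s\<in>{0..\<sigma>}. H k s = s *\<^sub>R c 0)"
  proof (induction k)
    case 0
    show ?case by (auto simp: scaleR_add_left[symmetric])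
  next
    case (Suc k)
    have "H (Suc k) s + H (Suc k) (1 - s) = c (Suc k)" if s: "s \<in> {0..1}" for s
    proof -
      have pos: "a k s + a k (1 - s) > 0"
        using mobility_pos_aux Suc.IH s by auto
      have "a k s / (a k s + a k (1 - s)) + a k (1 - s) / (a k (1 - s) + a k s) = 1"
        using pos by (simp add: add.commute add_divide_distrib[symmetric])
      then have "(a k s / (a k s + a k (1 - s))) *\<^sub>R (c (Suc k) - c k) +
          (a k (1 - s) / (a k (1 - s) + a k s)) *\<^sub>R (c (Suc k) - c k) = c (Suc k) - c k"
        (is "?p + ?q = _")
        by (metis scaleR_add_left scaleR_one)
      moreover have "H k s + H k (1 - s) = c k"
        using Suc.IH s by blast
      moreover have "H (Suc k) s = H k s + ?p" "H (Suc k) (1 - s) = H k (1 - s) + ?q"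
        unfolding deformed_path_Suc by simp_all
      ultimately show ?thesis by algebra
    qed
    moreover have "H (Suc k) s = s *\<^sub>R c 0" if "s \<in> {0..\<sigma>}" for s
      using Suc.IH that unfolding deformed_path_Suc by (simp add: mobility_def)
    ultimately show ?case by blast
  qed
  then show "0 \<le> s \<Longrightarrow> s \<le> 1 \<Longrightarrow> H k s + H k (1 - s) = c k"
    and "0 \<le> s \<Longrightarrow> s \<le> \<sigma> \<Longrightarrow> H k s = s *\<^sub>R c 0"
    by auto
qed

lemma mobility_pos: "0 \<le> s \<Longrightarrow> s \<le> 1 \<Longrightarrow> a k s + a k (1 - s) > 0"
  using mobility_pos_aux deformed_path_sym deformed_path_fixed by blast

lemma deformed_path_step:
  assumes "0 \<le> s" "s \<le> 1"
  shows "dist (H k s) (H (Suc k) s) \<le> dist (c k) (c (Suc k))"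
proof -
  have "0 \<le> a k s / (a k s + a k (1 - s))" "a k s / (a k s + a k (1 - s)) \<le> 1"
    using mobility_pos[OF assms, of k] mobility_nonneg[of \<Omega> \<sigma> \<delta> "H k"] by (auto simp: divide_simps)
  then have "\<bar>a k s / (a k s + a k (1 - s))\<bar> * norm (c (Suc k) - c k) \<le> 1 * norm (c (Suc k) - c k)"
    by (intro mult_right_mono) (simp_all only: abs_of_nonneg norm_ge_zero)
  then show ?thesis
    unfolding deformed_path_Suc by (simp add: dist_norm norm_minus_commute)
qed

text \<open>A point within \<delta> of \<Omega> stays put in the next step and any other moves by at
  most \<delta> / 2, so the bound does not deteriorate with k.\<close>

lemma deformed_path_far:
  assumes "\<sigma> \<le> s" "s \<le> 1"
  shows "\<delta> / 2 \<le> infdist (H k s) \<Omega>"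
proof (induction k)
  case 0
  then show ?case using far0[OF assms] by simp
next
  case (Suc k)
  show ?case
  proof (cases "infdist (H k s) \<Omega> \<le> \<delta>")
    case True
    then have "H (Suc k) s = H k s"
      unfolding deformed_path_Suc by (simp add: mobility_def)
    then show ?thesis using Suc.IH by simp
  next
    case False
    have "dist (H k s) (H (Suc k) s) \<le> \<delta> / 2"
      using deformed_path_step[of s k] short[of k] assms sigma by linarith
    then show ?thesis
      using False infdist_triangle[of "H k s" \<Omega> "H (Suc k) s"] by linarith
  qed
qed

lemma deformed_path_continuous: "continuous_on {0..1} (H k)"
proof (induction k)
  case 0
  show ?case by (auto intro!: continuous_intros)
next
  case (Suc k)
  have a: "continuous_on {0..1} (a k)"
    unfolding mobility_def[abs_def] by (intro continuous_intros Suc)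
  moreover have "continuous_on {0..1} (\<lambda>s. a k (1 - s))"
    by (rule continuous_on_compose2[OF a]) (auto intro!: continuous_intros)
  moreover have "a k s + a k (1 - s) \<noteq> 0" if "s \<in> {0..1}" for s
    using mobility_pos[of s k] that by auto
  ultimately have "continuous_on {0..1} (\<lambda>s. H k s + (a k s / (a k s + a k (1 - s))) *\<^sub>R (c (Suc k) - c k))"
    using Suc by (intro continuous_intros) auto
  then show ?case by (simp add: deformed_path_Suc[abs_def])
qed

end

section \<open>Distances to the singular set, meshes and existence of branch grids\<close>

lemma infdist_ge:
  assumes "A \<noteq> {}" "\<And>a. a \<in> A \<Longrightarrow> d \<le> dist x a"
  shows "d \<le> infdist x A"
  using assms by (auto simp: infdist_notempty intro!: cINF_greatest)

lemma compact_far_from_closed: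
  fixes S \<Omega> :: "complex set"
  assumes "compact S" "closed \<Omega>" "S \<inter> \<Omega> = {}" "\<Omega> \<noteq> {}"
  obtains d where "d > 0" "\<And>x. x \<in> S \<Longrightarrow> d \<le> infdist x \<Omega>"
proof -
  obtain d where d: "d > 0" "\<forall>x\<in>S. \<forall>y\<in>\<Omega>. d \<le> dist x y"
    using separate_compact_closed[OF assms(1-3)] by auto
  then have "d \<le> infdist x \<Omega>" if "x \<in> S" for x
    using infdist_ge[OF assms(4)] that by blast
  with d(1) show thesis by (rule that)
qed

lemma infdist_ge_imp_ball_disjoint:
  assumes "\<rho> \<le> infdist x A"
  shows "ball x \<rho> \<inter> A = {}"
  using infdist_le[of _ A x] assms by force

text \<open>For each path the estimate holds for all large N by uniform continuity, so finitely many
  paths have a common N.\<close>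

lemma eventually_uniform_mesh:
  fixes h :: "nat \<Rightarrow> real \<Rightarrow> complex"
  assumes "\<And>k. k \<le> K \<Longrightarrow> continuous_on {0..1} (h k)" "e > 0"
  obtains N where "N > 0"
    "\<And>k j. k \<le> K \<Longrightarrow> j < N \<Longrightarrow> dist (h k (real j / real N)) (h k (real (Suc j) / real N)) \<le> e"
proof -
  have "\<forall>\<^sub>F N in sequentially. \<forall>k\<in>{..K}. \<forall>j<N. dist (h k (real j / real N)) (h k (real (Suc j) / real N)) \<le> e"
  proof (rule eventually_ball_finite)
    show "\<forall>k\<in>{..K}. \<forall>\<^sub>F N in sequentially. \<forall>j<N. dist (h k (real j / real N)) (h k (real (Suc j) / real N)) \<le> e"
    proof
      fix k assume "k \<in> {..K}"
      then have "uniformly_continuous_on {0..1} (h k)"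
        using assms(1) by (intro compact_uniformly_continuous) auto
      then obtain d where d: "d > 0" "\<And>s t. s \<in> {0..1} \<Longrightarrow> t \<in> {0..1} \<Longrightarrow> dist s t < d \<Longrightarrow> dist (h k s) (h k t) < e"
        using assms(2) unfolding uniformly_continuous_on_def by metis
      obtain n where n: "n > 0" "1 / real n < d"
        using d(1) by (metis inverse_eq_divide ex_inverse_of_nat_less)
      have "dist (h k (real j / real N)) (h k (real (Suc j) / real N)) \<le> e" if "N \<ge> n" "j < N" for N j
      proof (rule less_imp_le, rule d(2))
        have "dist (real j / real N) (real (Suc j) / real N) = 1 / real N"
          by (simp add: dist_real_def diff_divide_distrib[symmetric])
        moreover have "1 / real N \<le> 1 / real n"
          using that n(1) by (simp add: divide_simps)
        ultimately show "dist (real j / real N) (real (Suc j) / real N) < d"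
          using n(2) by linarith
      qed (use that in \<open>auto simp: divide_simps\<close>)
      then show "\<forall>\<^sub>F N in sequentially. \<forall>j<N. dist (h k (real j / real N)) (h k (real (Suc j) / real N)) \<le> e"
        unfolding eventually_sequentially by blast
    qed
  qed simp
  then obtain n where n: "\<And>N k j. N \<ge> n \<Longrightarrow> k \<le> K \<Longrightarrow> j < N \<Longrightarrow>
      dist (h k (real j / real N)) (h k (real (Suc j) / real N)) \<le> e"
    unfolding eventually_sequentially by auto
  show thesis
    by (rule that[of "Suc n"]) (use n[of "Suc n"] in auto)
qed

text \<open>A column that never moves carries \<phi> itself; its disc may contain a singularity at
  0. A column of the second kind is a chain of discs off \<Omega> along which \<phi> is
  continued.\<close>

lemma (in path_grid) branch_grid_exists:
  assumes \<phi>: "continuable_outside \<Omega> R \<phi>" "\<phi> holomorphic_on ball 0 R"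
    and j0: "\<And>j. j \<le> N \<Longrightarrow> ball (v 0 j) \<rho> \<subseteq> ball 0 R"
    and alt: "\<And>j. j \<le> N \<Longrightarrow> (\<forall>k. v k j = v 0 j) \<or>
      v 0 j \<in> punctured_disc R \<and> (\<forall>k. ball (v k j) \<rho> \<inter> \<Omega> = {})"
  obtains f where "branch_grid \<phi> f"
proof -
  have "\<exists>F. (\<forall>z\<in>ball (v 0 j) \<rho>. F 0 z = \<phi> z) \<and> (\<forall>k. F k holomorphic_on ball (v k j) \<rho> \<and>
        (\<forall>z\<in>ball (v k j) \<rho> \<inter> ball (v (Suc k) j) \<rho>. F (Suc k) z = F k z))" if j: "j \<le> N" for j
    using alt[OF j]
  proof
    assume const: "\<forall>k. v k j = v 0 j"
    have "\<phi> holomorphic_on ball (v k j) \<rho>" for k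
      using holomorphic_on_subset[OF \<phi>(2) j0[OF j]] const by metis
    then show ?thesis by (intro exI[of _ "\<lambda>_. \<phi>"]) auto
  next
    assume *: "v 0 j \<in> punctured_disc R \<and> (\<forall>k. ball (v k j) \<rho> \<inter> \<Omega> = {})"
    have hol: "\<phi> holomorphic_on ball (v 0 j) \<rho>"
      using holomorphic_on_subset[OF \<phi>(2) j0[OF j]] .
    then have "\<phi> analytic_on {v 0 j}"
      using rho_pos by (meson analytic_at centre_in_ball open_ball)
    moreover have "dist (v k j) (v (Suc k) j) < \<rho>" for k
      using step[OF j, of k] rho_pos by linarith
    ultimately obtain F where F: "\<And>k. F k holomorphic_on ball (v k j) \<rho>"
      "\<And>k z. z \<in> ball (v k j) \<rho> \<Longrightarrow> z \<in> ball (v (Suc k) j) \<rho> \<Longrightarrow> F (Suc k) z = F k z"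
      "\<forall>\<^sub>F z in nhds (v 0 j). F 0 z = \<phi> z"
      using branch_chain[OF \<phi>(1), of "\<lambda>k. v k j" \<rho>] * by auto
    \<comment> \<open>The chain matches \<phi> near \<open>v 0 j\<close>; the identity theorem
      extends this to the whole disc, as \<open>branch_grid\<close> demands.\<close>
    have "F 0 z = \<phi> z" if "z \<in> ball (v 0 j) \<rho>" for z
      using holomorphic_eq_on_ball_Int[OF F(1) hol F(3)] that rho_pos by auto
    then show ?thesis using F by (intro exI[of _ F]) auto
  qed
  then obtain F where F: "\<And>j. j \<le> N \<Longrightarrow> (\<forall>z\<in>ball (v 0 j) \<rho>. F j 0 z = \<phi> z) \<and>
      (\<forall>k. F j k holomorphic_on ball (v k j) \<rho> \<and>
        (\<forall>z\<in>ball (v k j) \<rho> \<inter> ball (v (Suc k) j) \<rho>. F j (Suc k) z = F j k z))"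
    by metis
  then have "branch_grid \<phi> (\<lambda>k j. F j k)"
    unfolding branch_grid_def by blast
  then show thesis by (rule that)
qed

section \<open>From a finite chain of discs to a continuation along a path\<close>

lemma floor_mult_bounds:
  assumes "0 \<le> t" "t \<le> 1" "K > 0"
  shows "nat \<lfloor>t * real K\<rfloor> \<le> K" "\<bar>t - real (nat \<lfloor>t * real K\<rfloor>) / real K\<bar> \<le> 1 / real K"
proof -
  have "t * real K \<le> real K"
    using assms by (simp add: mult_left_le_one_le)
  then show "nat \<lfloor>t * real K\<rfloor> \<le> K" by linarith
  have "real (nat \<lfloor>t * real K\<rfloor>) = of_int \<lfloor>t * real K\<rfloor>"
    using assms by simp
  then have "\<bar>t * real K - real (nat \<lfloor>t * real K\<rfloor>)\<bar> \<le> 1" by linarith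
  moreover have "t - real (nat \<lfloor>t * real K\<rfloor>) / real K = (t * real K - real (nat \<lfloor>t * real K\<rfloor>)) / real K"
    using assms(3) by (simp add: field_simps)
  ultimately show "\<bar>t - real (nat \<lfloor>t * real K\<rfloor>) / real K\<bar> \<le> 1 / real K"
    using assms(3) by (simp add: divide_right_mono)
qed

lemma floor_mult_near:
  assumes "0 \<le> s" "0 \<le> t" "\<bar>s - t\<bar> < 1 / real K" "K > 0"
  shows "nat \<lfloor>s * real K\<rfloor> = nat \<lfloor>t * real K\<rfloor> \<or> nat \<lfloor>s * real K\<rfloor> = Suc (nat \<lfloor>t * real K\<rfloor>)
    \<or> nat \<lfloor>t * real K\<rfloor> = Suc (nat \<lfloor>s * real K\<rfloor>)"
proof -
  have "\<bar>s - t\<bar> * real K < 1"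
    using assms(3,4) by (simp add: field_simps)
  moreover have "\<bar>s - t\<bar> * real K = \<bar>s * real K - t * real K\<bar>"
    by (simp add: abs_mult left_diff_distrib[symmetric])
  moreover have "0 \<le> s * real K" "0 \<le> t * real K"
    using assms by auto
  ultimately show ?thesis by linarith
qed

text \<open>Parameters closer than 1 / K have equal or consecutive indices. The radius
  \<open>4 * r\<close> leaves room for \<open>\<gamma> s\<close> in a neighbouring disc too, whose
  centre is at distance at most \<open>2 * r\<close>.\<close>

lemma continuation_along_of_disc_chain:
  fixes G :: "nat \<Rightarrow> complex \<Rightarrow> complex"
  assumes K: "K > 0" and r: "r > 0"
    and G: "\<And>k. k \<le> K \<Longrightarrow> G k holomorphic_on ball (c k) (4 * r)"
    and near: "\<And>k t. k \<le> K \<Longrightarrow> t \<in> {0..1} \<Longrightarrow> \<bar>t - real k / real K\<bar> \<le> 1 / real K \<Longrightarrow> dist (c k) (\<gamma> t) \<le> r"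
    and cc: "\<And>k. dist (c k) (c (Suc k)) \<le> r"
    and agree: "\<And>k z. k < K \<Longrightarrow> dist (c k) z < 4 * r \<Longrightarrow> dist (c (Suc k)) z < 4 * r \<Longrightarrow> G (Suc k) z = G k z"
    and start: "\<forall>\<^sub>F z in nhds (\<gamma> 0). G 0 z = f z"
  shows "continuation_along f \<gamma> (\<lambda>t. G (nat \<lfloor>t * real K\<rfloor>))"
proof -
  let ?k = "\<lambda>t. nat \<lfloor>t * real K\<rfloor>"
  have kt: "?k t \<le> K" "dist (c (?k t)) (\<gamma> t) \<le> r" if "t \<in> {0..1}" for t
    using floor_mult_bounds[of t K] near[of "?k t" t] that K by auto
  have glue: "\<forall>\<^sub>F z in nhds (\<gamma> s). G (Suc k) z = G k z"
    if "k < K" "dist (c k) (\<gamma> s) < 4 * r" "dist (c (Suc k)) (\<gamma> s) < 4 * r" for k s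
  proof -
    have "\<forall>\<^sub>F z in nhds (\<gamma> s). z \<in> ball (c k) (4 * r) \<inter> ball (c (Suc k)) (4 * r)"
      using that by (intro eventually_nhds_in_open) auto
    then show ?thesis
      by eventually_elim (use agree[OF that(1)] in auto)
  qed
  have "coherent_along {0..1} \<gamma> (\<lambda>t. G (?k t))"
    unfolding coherent_along_def
  proof (intro conjI ballI)
    fix t :: real assume t: "t \<in> {0..1}"
    have "\<gamma> t \<in> ball (c (?k t)) (4 * r)"
      using kt(2)[OF t] r by simp
    then show "G (?k t) analytic_on {\<gamma> t}"
      using G[OF kt(1)[OF t]] by (meson analytic_at open_ball)
    have "\<forall>\<^sub>F z in nhds (\<gamma> s). G (?k s) z = G (?k t) z" if s: "s \<in> {0..1}" "dist s t < 1 / real K" for s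
    proof -
      consider "?k s = ?k t" | "?k s = Suc (?k t)" | "?k t = Suc (?k s)"
        using floor_mult_near[of s t K] s t K by (auto simp: dist_real_def)
      then show ?thesis
      proof cases
        case 1
        then show ?thesis by simp
      next
        case 2
        have "dist (c (?k t)) (\<gamma> s) \<le> dist (c (?k t)) (c (Suc (?k t))) + dist (c (Suc (?k t))) (\<gamma> s)"
          by (rule dist_triangle)
        then show ?thesis
          using glue[of "?k t" s] 2 kt[OF s(1)] cc[of "?k t"] r by simp
      next
        case 3
        have "dist (c (Suc (?k s))) (\<gamma> s) \<le> dist (c (?k s)) (c (Suc (?k s))) + dist (c (?k s)) (\<gamma> s)"
          by (metis dist_commute dist_triangle)
        then have "\<forall>\<^sub>F z in nhds (\<gamma> s). G (Suc (?k s)) z = G (?k s) z"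
          using glue[of "?k s" s] 3 kt[OF s(1)] kt(1)[OF t] cc[of "?k s"] r by simp
        then show ?thesis
          unfolding 3 by eventually_elim simp
      qed
    qed
    then show "\<exists>d>0. \<forall>s\<in>{0..1}. dist s t < d \<longrightarrow> (\<forall>\<^sub>F z in nhds (\<gamma> s). G (?k s) z = G (?k t) z)"
      using K by (intro exI[of _ "1 / real K"]) auto
  qed
  then show ?thesis
    using start by (simp add: continuation_along_iff)
qed

text \<open>Here the constants are chosen that turn \<gamma> into a \<open>deformation\<close>, its
  discretisation into a \<open>path_grid\<close>, and the integrals \<open>conv\<close> over the
  rows into a continuation of h.\<close>

lemma convolution_continuable_along:
  fixes \<phi> \<psi> h :: "complex \<Rightarrow> complex"
  assumes \<Omega>: "closed \<Omega>" "\<Omega> \<noteq> {}" "\<And>\<omega> \<omega>'. \<omega> \<in> \<Omega> \<Longrightarrow> \<omega>' \<in> \<Omega> \<Longrightarrow> \<omega> + \<omega>' \<in> \<Omega>"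
    and disc: "punctured_disc R \<inter> \<Omega> = {}"
    and \<phi>: "continuable_outside \<Omega> R \<phi>" "\<phi> holomorphic_on ball 0 R"
    and \<psi>: "continuable_outside \<Omega> R \<psi>" "\<psi> holomorphic_on ball 0 R"
    and h: "\<And>z. norm z < R \<Longrightarrow> h z = contour_integral (linepath 0 z) (\<lambda>\<xi>. \<phi> \<xi> * \<psi> (z - \<xi>))"
    and \<gamma>: "path \<gamma>" "path_image \<gamma> \<subseteq> - \<Omega>" "pathstart \<gamma> \<in> punctured_disc R"
  shows "continuable_along h \<gamma>"
proof -
  define p where "p = \<gamma> 0"
  have p: "0 < norm p" "norm p < R"
    using \<gamma>(3) by (auto simp: p_def pathstart_def punctured_disc_def)
  obtain d where d: "d > 0" "\<And>x. x \<in> path_image \<gamma> \<Longrightarrow> d \<le> infdist x \<Omega>"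
    using compact_far_from_closed[OF compact_path_image[OF \<gamma>(1)] \<Omega>(1) _ \<Omega>(2)] \<gamma>(2) by blast
  \<comment> \<open>Below 1/2, and small enough for \<open>\<sigma> * norm p\<close> to be at most d
    / 2.\<close>
  define \<sigma> where "\<sigma> = min (1/4) (d / (2 * norm p))"
  have \<sigma>: "0 < \<sigma>" "\<sigma> < 1/2" "\<sigma> * norm p \<le> d / 2"
  proof -
    have "\<sigma> * norm p \<le> d / (2 * norm p) * norm p"
      unfolding \<sigma>_def by (intro mult_right_mono) auto
    then show "\<sigma> * norm p \<le> d / 2" using p by simp
  qed (use d p in \<open>auto simp: \<sigma>_def\<close>)
  have scaled: "s *\<^sub>R p \<in> punctured_disc R" if "\<sigma> \<le> s" "s \<le> 1" for s
  proof -
    have "norm (s *\<^sub>R p) \<le> 1 * norm p"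
      using that \<sigma>(1) unfolding norm_scaleR by (intro mult_right_mono) auto
    then have "norm (s *\<^sub>R p) < R" using p(2) by linarith
    moreover have "0 < norm (s *\<^sub>R p)"
      using that \<sigma>(1) p(1) by simp
    ultimately show ?thesis unfolding punctured_disc_def by blast
  qed
  have "compact ((\<lambda>s. s *\<^sub>R p) ` {\<sigma>..1})"
    by (intro compact_continuous_image continuous_intros) auto
  moreover have "(\<lambda>s. s *\<^sub>R p) ` {\<sigma>..1} \<inter> \<Omega> = {}"
    using scaled disc by fastforce
  ultimately obtain e where e: "e > 0" "\<And>x. x \<in> (\<lambda>s. s *\<^sub>R p) ` {\<sigma>..1} \<Longrightarrow> e \<le> infdist x \<Omega>"
    using compact_far_from_closed[OF _ \<Omega>(1) _ \<Omega>(2)] by metis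
  \<comment> \<open>The bound d / 4 gives both \<open>2 * \<delta> < d\<close> and
    \<open>\<sigma> * norm p + \<delta> < d\<close>; e is the distance kept from \<Omega> by the
    initial segment beyond \<sigma>; \<open>R - norm p\<close> keeps the discs of row 0 inside
    \<open>ball 0 R\<close>.\<close>
  define \<delta> where "\<delta> = min (d / 4) (min e (R - norm p))"
  \<comment> \<open>The distance that moving vertices keep from \<Omega>, so that discs of this
    radius around them are free of singularities.\<close>
  define \<rho> where "\<rho> = \<delta> / 2"
  have \<delta>: "\<delta> > 0" "\<delta> \<le> d / 4" "\<delta> \<le> e" "\<delta> \<le> R - norm p"
    using d(1) e(1) p by (simp_all add: \<delta>_def min_def)
  have \<rho>: "\<rho> > 0" "norm p + \<rho> \<le> R" using \<delta> by (auto simp: \<rho>_def)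
  have "uniformly_continuous_on {0..1} \<gamma>"
    using \<gamma>(1) by (intro compact_uniformly_continuous) (auto simp: path_def)
  moreover have "\<rho> / 8 > 0" using \<rho> by simp
  ultimately obtain u where u: "u > 0"
    "\<And>s t. s \<in> {0..1} \<Longrightarrow> t \<in> {0..1} \<Longrightarrow> dist s t < u \<Longrightarrow> dist (\<gamma> s) (\<gamma> t) < \<rho> / 8"
    unfolding uniformly_continuous_on_def by metis
  obtain K where K: "K > 0" "1 / real K < u"
    using u(1) by (metis inverse_eq_divide ex_inverse_of_nat_less)
  \<comment> \<open>Constant from K on: the deformation is indexed by all natural numbers, while
    \<gamma> is used up at k = K.\<close>
  define c where "c k = \<gamma> (min 1 (real k / real K))" for k
  have c_near: "dist (c k) (\<gamma> t) \<le> \<rho> / 8" if "t \<in> {0..1}" "\<bar>t - min 1 (real k / real K)\<bar> \<le> 1 / real K" for k t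
    unfolding c_def
  proof (intro less_imp_le u(2))
    show "dist (min 1 (real k / real K)) t < u"
      using that(2) K(2) unfolding dist_real_def by linarith
  qed (use that in auto)
  have c_step: "dist (c k) (c (Suc k)) \<le> \<rho> / 8" for k
  proof -
    have "real (Suc k) / real K = real k / real K + 1 / real K"
      by (simp add: add_divide_distrib)
    moreover have "0 \<le> 1 / real K" by simp
    ultimately have "\<bar>min 1 (real (Suc k) / real K) - min 1 (real k / real K)\<bar> \<le> 1 / real K"
      unfolding min_def by (smt (verit))
    then show ?thesis
      unfolding c_def[of "Suc k"] by (intro c_near) auto
  qed
  have c0: "c 0 = p" by (simp add: c_def p_def)
  have c_im: "c k \<in> path_image \<gamma>" for k
    by (auto simp: c_def path_image_def)
  interpret deformation \<Omega> \<sigma> \<delta> d c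
  proof
    show "2 * \<delta> < d" using \<delta> d by linarith
    show "\<sigma> * norm (c 0) + \<delta> < d" using \<sigma>(3) \<delta> d unfolding c0 by linarith
    show "dist (c k) (c (Suc k)) \<le> \<delta> / 2" for k
      using c_step[of k] \<delta>(1) by (simp add: \<rho>_def)
    show "\<delta> / 2 \<le> infdist (s *\<^sub>R c 0) \<Omega>" if "\<sigma> \<le> s" "s \<le> 1" for s
    proof -
      have "s *\<^sub>R p \<in> (\<lambda>s. s *\<^sub>R p) ` {\<sigma>..1}"
        using that by (intro imageI) simp
      then show ?thesis
        using e(2)[of "s *\<^sub>R p"] \<delta>(1,3) unfolding c0 by linarith
    qed
  qed (use \<Omega> \<sigma> \<delta> d(2) c_im in auto)
  obtain N where N: "N > 0"
    "\<And>k j. k \<le> K \<Longrightarrow> j < N \<Longrightarrow> dist (H k (real j / real N)) (H k (real (Suc j) / real N)) \<le> \<rho> / 8"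
    using eventually_uniform_mesh[of K H "\<rho> / 8"] deformed_path_continuous \<rho> by auto
  define v where "v k j = H k (real j / real N)" for k j
  have v0: "v k 0 = 0" for k
    using deformed_path_fixed[of 0 k] \<sigma> by (simp add: v_def)
  \<comment> \<open>At s = 0 the symmetry says that \<open>H k 0\<close> and \<open>H k 1\<close>
    add up to \<open>c k\<close>, and \<open>H k 0\<close> is 0.\<close>
  have vN: "v k N = c k" for k
    using deformed_path_sym[of 0 k] v0[of k] N(1) by (simp add: v_def)
  have v00: "v 0 j = (real j / real N) *\<^sub>R p" for j
    by (simp add: v_def c0)
  interpret path_grid v N K \<rho>
  proof
    show "v k j + v k (N - j) = v k N" if "j \<le> N" for k j
    proof -
      have "real (N - j) / real N = 1 - real j / real N"
        using that N(1) by (simp add: of_nat_diff diff_divide_distrib)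
      then show ?thesis
        using deformed_path_sym[of "real j / real N" k] that N(1) unfolding vN by (simp add: v_def)
    qed
    show "dist (v k j) (v (Suc k) j) \<le> \<rho> / 8" if "j \<le> N" for k j
      using deformed_path_step[of "real j / real N" k] c_step[of k] that N(1) by (simp add: v_def)
  qed (use \<rho> v0 N in \<open>auto simp: v_def\<close>)
  have sub: "ball (v 0 j) \<rho> \<subseteq> ball 0 R" if j: "j \<le> N" for j
  proof -
    have "norm (v 0 j) = (real j / real N) * norm p"
      unfolding v00 by simp
    also have "\<dots> \<le> 1 * norm p"
      using j N(1) by (intro mult_right_mono) auto
    finally have "dist (v 0 j) 0 + \<rho> \<le> R" using \<rho> by simp
    then show ?thesis by (simp add: ball_subset_ball_iff)
  qed
  \<comment> \<open>Vertices with parameter at most \<sigma> never move; all others keep distance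
    \<rho> from \<Omega> and start in the punctured disc.\<close>
  have alt: "(\<forall>k. v k j = v 0 j) \<or> v 0 j \<in> punctured_disc R \<and> (\<forall>k. ball (v k j) \<rho> \<inter> \<Omega> = {})"
    if j: "j \<le> N" for j
  proof (cases "real j / real N \<le> \<sigma>")
    case True
    then show ?thesis
      using deformed_path_fixed[of "real j / real N"] by (simp add: v_def)
  next
    case False
    have "\<rho> \<le> infdist (v k j) \<Omega>" for k
      using deformed_path_far[of "real j / real N" k] False j N(1) by (simp add: v_def \<rho>_def)
    then have "ball (v k j) \<rho> \<inter> \<Omega> = {}" for k
      by (rule infdist_ge_imp_ball_disjoint)
    moreover have "v 0 j \<in> punctured_disc R"
      using scaled[of "real j / real N"] False j N(1) unfolding v00 by simp
    ultimately show ?thesis by blast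
  qed
  obtain f where f: "branch_grid \<phi> f" using branch_grid_exists[OF \<phi> sub alt] by blast
  obtain g where g: "branch_grid \<psi> g" using branch_grid_exists[OF \<psi> sub alt] by blast
  \<comment> \<open>With r = \<rho> / 8, the radius \<open>4 * r\<close> is the \<rho> / 2 on which
    \<open>conv\<close> is holomorphic, and the steps of c are at most r.\<close>
  have "continuation_along h \<gamma> (\<lambda>t. conv f g (nat \<lfloor>t * real K\<rfloor>))"
  proof (rule continuation_along_of_disc_chain[where r = "\<rho> / 8" and c = c])
    show "conv f g k holomorphic_on ball (c k) (4 * (\<rho> / 8))" if "k \<le> K" for k
      using conv_holomorphic[OF f g that] by (simp add: vN)
    show "dist (c k) (\<gamma> t) \<le> \<rho> / 8" if "k \<le> K" "t \<in> {0..1}" "\<bar>t - real k / real K\<bar> \<le> 1 / real K" for k t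
      using c_near[of t k] that K(1) by simp
    show "conv f g (Suc k) z = conv f g k z"
      if "k < K" "dist (c k) z < 4 * (\<rho> / 8)" "dist (c (Suc k)) z < 4 * (\<rho> / 8)" for k z
      using conv_step[OF f g that(1), of z] that by (simp add: vN)
    have "\<forall>\<^sub>F z in nhds p. z \<in> ball p (\<rho> / 2)"
      using \<rho> by (intro eventually_nhds_in_open) auto
    then show "\<forall>\<^sub>F z in nhds (\<gamma> 0). conv f g 0 z = h z"
      unfolding p_def[symmetric]
    proof eventually_elim
      case (elim z)
      then have "norm z < R"
        using \<rho> norm_triangle_ineq2[of z p] by (simp add: dist_norm norm_minus_commute)
      moreover have "conv f g 0 z = contour_integral (linepath 0 z) (\<lambda>\<xi>. \<phi> \<xi> * \<psi> (z - \<xi>))"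
        by (rule conv_start[OF f g \<phi>(2) \<psi>(2)]) (use elim \<rho>(2) v00 in \<open>auto simp: vN c0\<close>)
      ultimately show ?case using h by simp
    qed
  qed (use K \<rho> c_step in auto)
  then show ?thesis
    unfolding continuable_along_def by blast
qed

subsection \<open>Convolution of simple poles\<close>

text \<open>The fundamental theorem of calculus for a multivalued primitive: for s near t,
  \<open>F s (\<gamma> s)\<close> equals \<open>F t (\<gamma> s)\<close> with t fixed, so it is
  continuous in s, and differentiable off the finitely many corners of \<gamma>.\<close>

lemma has_contour_integral_of_local_primitives:
  assumes F: "coherent_along {0..1} \<gamma> F" and \<gamma>: "valid_path \<gamma>"
    and der: "\<And>t. t \<in> {0..1} \<Longrightarrow> (F t has_field_derivative r (\<gamma> t)) (at (\<gamma> t))"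
  shows "(r has_contour_integral (F 1 (\<gamma> 1) - F 0 (\<gamma> 0))) \<gamma>"
proof -
  obtain S where S: "finite S" and C1: "\<gamma> C1_differentiable_on {0..1} - S" and cont: "continuous_on {0..1} \<gamma>"
    using \<gamma> unfolding valid_path_def piecewise_C1_differentiable_on_def by blast
  define u where "u t = F t (\<gamma> t)" for t
  have loc: "\<exists>d>0. \<forall>s\<in>{0..1}. dist s t < d \<longrightarrow> u s = F t (\<gamma> s)" if t: "t \<in> {0..1}" for t
  proof -
    obtain d where d: "d > 0" "\<And>s. s \<in> {0..1} \<Longrightarrow> dist s t < d \<Longrightarrow> \<forall>\<^sub>F z in nhds (\<gamma> s). F s z = F t z"
      using coherent_alongE[OF F t] by metis
    then have "\<forall>s\<in>{0..1}. dist s t < d \<longrightarrow> u s = F t (\<gamma> s)"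
      unfolding u_def using eventually_nhds_x_imp_x by blast
    with d(1) show ?thesis by blast
  qed
  have "continuous_on {0..1} u"
    unfolding continuous_on_eq_continuous_within
  proof
    fix t :: real assume t: "t \<in> {0..1}"
    obtain d where d: "d > 0" "\<forall>s\<in>{0..1}. dist s t < d \<longrightarrow> u s = F t (\<gamma> s)"
      using loc[OF t] by blast
    have "continuous (at t within {0..1}) \<gamma>"
      using cont t by (simp add: continuous_on_eq_continuous_within)
    moreover have "isCont (F t) (\<gamma> t)"
      using der[OF t] by (rule DERIV_isCont)
    ultimately have "continuous (at t within {0..1}) (\<lambda>s. F t (\<gamma> s))"
      by (rule continuous_within_compose3[rotated])
    then show "continuous (at t within {0..1}) u"
      by (rule continuous_transform_within[OF _ d(1) t]) (use d(2) in auto)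
  qed
  moreover have "(u has_vector_derivative r (\<gamma> t) * vector_derivative \<gamma> (at t)) (at t)"
    if t: "t \<in> {0<..<1} - S" for t
  proof -
    have t': "t \<in> {0..1}" using t by auto
    obtain d where d: "d > 0" "\<forall>s\<in>{0..1}. dist s t < d \<longrightarrow> u s = F t (\<gamma> s)"
      using loc[OF t'] by blast
    have "(\<gamma> has_vector_derivative vector_derivative \<gamma> (at t)) (at t)"
      using C1 t by (auto simp: C1_differentiable_on_eq vector_derivative_works)
    then have "(F t \<circ> \<gamma> has_vector_derivative vector_derivative \<gamma> (at t) * r (\<gamma> t)) (at t)"
      using der[OF t'] by (rule field_vector_diff_chain_at)
    then have *: "(F t \<circ> \<gamma> has_vector_derivative r (\<gamma> t) * vector_derivative \<gamma> (at t)) (at t)"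
      by (simp add: mult.commute)
    show ?thesis
      by (rule has_vector_derivative_transform_within_open[OF *, of "ball t d \<inter> {0<..<1}"])
        (use d t in \<open>auto simp: dist_commute\<close>)
  qed
  ultimately have "((\<lambda>t. r (\<gamma> t) * vector_derivative \<gamma> (at t)) has_integral (u 1 - u 0)) {0..1}"
    by (intro fundamental_theorem_of_calculus_interior_strong[OF S]) auto
  then show ?thesis
    by (simp add: has_contour_integral u_def)
qed

text \<open>T acts on germs and preserves analyticity. The instances are multiplication by a linear
  factor, and differentiation followed by subtraction of a fixed function.\<close>

lemma coherent_along_map:
  assumes F: "coherent_along S \<gamma> F"
    and local: "\<And>f g x. \<forall>\<^sub>F z in nhds x. f z = g z \<Longrightarrow> \<forall>\<^sub>F z in nhds x. T f z = T g z"
    and ana: "\<And>f t. t \<in> S \<Longrightarrow> f analytic_on {\<gamma> t} \<Longrightarrow> T f analytic_on {\<gamma> t}"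
  shows "coherent_along S \<gamma> (\<lambda>t. T (F t))"
  unfolding coherent_along_def
proof (intro conjI ballI)
  fix t assume t: "t \<in> S"
  show "T (F t) analytic_on {\<gamma> t}"
    using ana[OF t] coherent_along_analytic[OF F t] .
  obtain d where "d > 0" "\<And>s. s \<in> S \<Longrightarrow> dist s t < d \<Longrightarrow> \<forall>\<^sub>F z in nhds (\<gamma> s). F s z = F t z"
    using coherent_alongE[OF F t] by metis
  then show "\<exists>d>0. \<forall>s\<in>S. dist s t < d \<longrightarrow> (\<forall>\<^sub>F z in nhds (\<gamma> s). T (F s) z = T (F t) z)"
    using local by blast
qed

lemma eventually_deriv_cong:
  assumes "\<forall>\<^sub>F z in nhds x. f z = g z"
  shows "\<forall>\<^sub>F z in nhds x. deriv f z = deriv g z"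
proof -
  have "\<forall>\<^sub>F y in nhds x. \<forall>\<^sub>F z in nhds y. f z = g z"
    using assms by (simp add: eventually_eventually)
  then show ?thesis
    by eventually_elim (rule deriv_cong_ev, auto)
qed

section \<open>Paths and loops avoiding a closed discrete set\<close>

lemma discrete_closed_punctured_disc:
  fixes \<Omega> :: "complex set"
  assumes "closed \<Omega>" "discrete \<Omega>"
  obtains R where "R > 0" "ball x R \<inter> \<Omega> \<subseteq> {x}"
proof -
  have "\<not> x islimpt \<Omega>"
    using assms by (meson closed_limpt discreteD isolated_in_islimpt_iff)
  then obtain R where "R > 0" "\<forall>y\<in>\<Omega>. y \<noteq> x \<longrightarrow> R \<le> dist y x"
    unfolding islimpt_approachable by (metis linorder_not_less)
  then show thesis
    by (intro that[of R]) (force simp: dist_commute)+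
qed

lemma discrete_closed_complement_path:
  fixes \<Omega> :: "complex set"
  assumes "closed \<Omega>" "discrete \<Omega>" "x \<notin> \<Omega>" "y \<notin> \<Omega>"
  obtains q where "valid_path q" "path_image q \<subseteq> - \<Omega>" "pathstart q = x" "pathfinish q = y"
proof -
  have "\<not> z islimpt \<Omega>" for z
    using assms by (meson closed_limpt discreteD isolated_in_islimpt_iff)
  then have "\<Omega> sparse_in UNIV"
    by (simp add: sparse_in_open)
  then have "connected (- \<Omega>)"
    using sparse_imp_connected[OF _ connected_UNIV open_UNIV, of \<Omega>] by (simp add: Compl_eq_Diff_UNIV)
  then obtain q where "polynomial_function q" "path_image q \<subseteq> - \<Omega>" "pathstart q = x" "pathfinish q = y"
    using connected_open_polynomial_connected[of "- \<Omega>" x y] assms by auto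
  then show thesis
    using that valid_path_polynomial_function by blast
qed

text \<open>Walk to a small circle around \<omega>1, round it and back. The ways out and back
  cancel; the circle contributes a residue, which is doubled, not cancelled, if \<omega>1 =
  \<omega>2, and otherwise has no part from the pole \<omega>2 outside.\<close>

lemma loop_around_pole:
  fixes \<Omega> :: "complex set"
  assumes \<Omega>: "closed \<Omega>" "discrete \<Omega>" and w: "\<omega>1 \<in> \<Omega>" "\<omega>2 \<in> \<Omega>" "w \<notin> \<Omega>"
  obtains l where "valid_path l" "path_image l \<subseteq> - \<Omega>" "pathstart l = w" "pathfinish l = w"
    "contour_integral l (\<lambda>z. 1 / (\<omega>1 - z) + 1 / (\<omega>2 - z)) \<noteq> 0"
proof -
  let ?r = "\<lambda>z. 1 / (\<omega>1 - z) + 1 / (\<omega>2 - z)"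
  obtain R where R: "R > 0" "ball \<omega>1 R \<inter> \<Omega> \<subseteq> {\<omega>1}"
    using discrete_closed_punctured_disc[OF \<Omega>] by blast
  define C where "C = circlepath \<omega>1 (R / 2)"
  have C_ball: "path_image C \<subseteq> ball \<omega>1 R"
    using R(1) by (auto simp: C_def path_image_circlepath)
  have "\<omega>1 \<notin> path_image C"
    using R(1) by (simp add: C_def path_image_circlepath)
  then have C_im: "path_image C \<subseteq> - \<Omega>"
    using C_ball R(2) by blast
  have C: "valid_path C" "pathfinish C = pathstart C"
    by (auto simp: C_def)
  have "pathstart C \<notin> \<Omega>"
    using C_im pathstart_in_path_image by blast
  then obtain q where q: "valid_path q" "path_image q \<subseteq> - \<Omega>" "pathstart q = w" "pathfinish q = pathstart C"
    using discrete_closed_complement_path[OF \<Omega> w(3)] by blast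
  have hol: "?r holomorphic_on - \<Omega>"
    using w(1,2) by (auto intro!: holomorphic_intros)
  have int: "?r contour_integrable_on p" if "valid_path p" "path_image p \<subseteq> - \<Omega>" for p
    using contour_integrable_holomorphic_simple[OF hol _ that] \<Omega>(1) by (simp add: open_Compl)
  have "(\<lambda>z. 1 / (a - z)) = (\<lambda>z. - (1 / (z - a)))" for a :: complex
    by (metis minus_diff_eq minus_divide_right)
  then have c1: "((\<lambda>z. 1 / (\<omega>1 - z)) has_contour_integral - (2 * pi * \<i>)) C"
    using has_contour_integral_neg[OF Cauchy_integral_circlepath_simple[of "\<lambda>_. 1" \<omega>1 "R / 2" \<omega>1]] R(1)
    by (simp add: C_def)
  have "contour_integral C ?r \<noteq> 0"
  proof (cases "\<omega>2 = \<omega>1")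
    case True
    then have "(?r has_contour_integral - (2 * pi * \<i>) + - (2 * pi * \<i>)) C"
      using has_contour_integral_add[OF c1 c1] by simp
    then show ?thesis
      by (simp add: contour_integral_unique)
  next
    case False
    then have "\<omega>2 \<notin> ball \<omega>1 R"
      using R(2) w(2) by blast
    then have "(\<lambda>z. 1 / (\<omega>2 - z)) holomorphic_on ball \<omega>1 R"
      by (auto intro!: holomorphic_intros)
    then have "((\<lambda>z. 1 / (\<omega>2 - z)) has_contour_integral 0) C"
      using C C_ball by (intro Cauchy_theorem_disc_simple) auto
    from has_contour_integral_add[OF c1 this] show ?thesis
      by (simp add: contour_integral_unique)
  qed
  moreover have "contour_integral (q +++ C +++ reversepath q) ?r = contour_integral C ?r"
    using q C C_im int by (simp add: path_image_join contour_integral_reversepath contour_integrable_reversepath)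
  ultimately show thesis
    using q C C_im by (intro that[of "q +++ C +++ reversepath q"]) (auto simp: path_image_join)
qed

section \<open>Germs with a simple pole and their convolution\<close>

lemma has_field_derivative_Ln_pole:
  fixes a z :: complex
  assumes "norm z < norm a"
  shows "((\<lambda>z. - Ln (1 - z / a)) has_field_derivative 1 / (a - z)) (at z)"
proof -
  have a: "a \<noteq> 0" "a - z \<noteq> 0"
    using assms by auto
  have "norm (z / a) < 1"
    using assms by (simp add: norm_divide divide_simps)
  \<comment> \<open>A positive real part keeps the argument of \<open>Ln\<close> off its branch
    cut.\<close>
  then have "Re (1 - z / a) > 0"
    using complex_Re_le_cmod[of "z / a"] by simp
  then have "1 - z / a \<notin> \<real>\<^sub>\<le>\<^sub>0"
    by (auto simp: complex_nonpos_Reals_iff)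
  then show ?thesis
    using a by (auto intro!: derivative_eq_intros simp: field_simps)
qed

text \<open>Partial fractions: \<open>a + b - z\<close> is the sum of the two denominators, so
  multiplying by it turns the product of the poles into their sum, and each summand has a logarithm
  as primitive.\<close>

lemma segment_convolution_of_poles:
  fixes a b z :: complex
  assumes z: "norm z < norm a" "norm z < norm b"
  shows "(a + b - z) * contour_integral (linepath 0 z) (\<lambda>\<xi>. 1 / (a - \<xi>) * (1 / (b - (z - \<xi>)))) =
    - Ln (1 - z / a) - Ln (1 - z / b)"
proof -
  have seg: "norm \<xi> \<le> norm z" "norm (z - \<xi>) \<le> norm z" if "\<xi> \<in> closed_segment 0 z" for \<xi>
    using segment_bound[OF that] by (auto simp: norm_minus_commute)
  have ne: "a - \<xi> \<noteq> 0" "b - (z - \<xi>) \<noteq> 0" if "\<xi> \<in> closed_segment 0 z" for \<xi>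
    using seg[OF that] z by auto
  define P where "P \<xi> = - Ln (1 - \<xi> / a) - (- Ln (1 - (z - \<xi>) / b))" for \<xi>
  have "(P has_field_derivative 1 / (a - \<xi>) + 1 / (b - (z - \<xi>))) (at \<xi> within closed_segment 0 z)"
    if "\<xi> \<in> closed_segment 0 z" for \<xi>
  proof -
    have "((\<lambda>\<xi>. - Ln (1 - (z - \<xi>) / b)) has_field_derivative 1 / (b - (z - \<xi>)) * (0 - 1)) (at \<xi>)"
      by (rule DERIV_chain2[OF has_field_derivative_Ln_pole]) (use seg[OF that] z in \<open>auto intro!: derivative_eq_intros\<close>)
    moreover have "((\<lambda>\<xi>. - Ln (1 - \<xi> / a)) has_field_derivative 1 / (a - \<xi>)) (at \<xi>)"
      by (rule has_field_derivative_Ln_pole) (use seg[OF that] z in auto)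
    ultimately have "(P has_field_derivative 1 / (a - \<xi>) - 1 / (b - (z - \<xi>)) * (0 - 1)) (at \<xi>)"
      unfolding P_def[abs_def] by (intro DERIV_diff)
    then show ?thesis
      by (simp add: has_field_derivative_at_within)
  qed
  then have "((\<lambda>\<xi>. 1 / (a - \<xi>) + 1 / (b - (z - \<xi>))) has_contour_integral (P (pathfinish (linepath 0 z)) - P (pathstart (linepath 0 z)))) (linepath 0 z)"
    by (rule contour_integral_primitive) auto
  then have 1: "contour_integral (linepath 0 z) (\<lambda>\<xi>. 1 / (a - \<xi>) + 1 / (b - (z - \<xi>))) = P z - P 0"
    by (simp add: contour_integral_unique)
  have "(\<lambda>\<xi>. 1 / (a - \<xi>) * (1 / (b - (z - \<xi>)))) contour_integrable_on linepath 0 z"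
    using ne by (intro contour_integrable_continuous_linepath continuous_intros) auto
  then have "(a + b - z) * contour_integral (linepath 0 z) (\<lambda>\<xi>. 1 / (a - \<xi>) * (1 / (b - (z - \<xi>)))) =
      contour_integral (linepath 0 z) (\<lambda>\<xi>. (a + b - z) * (1 / (a - \<xi>) * (1 / (b - (z - \<xi>)))))"
    by (rule contour_integral_lmul[symmetric])
  also have "\<dots> = contour_integral (linepath 0 z) (\<lambda>\<xi>. 1 / (a - \<xi>) + 1 / (b - (z - \<xi>)))"
  proof (rule contour_integral_eq)
    fix \<xi> assume "\<xi> \<in> path_image (linepath 0 z)"
    then have "\<xi> \<in> closed_segment 0 z" by simp
    then show "(a + b - z) * (1 / (a - \<xi>) * (1 / (b - (z - \<xi>)))) = 1 / (a - \<xi>) + 1 / (b - (z - \<xi>))"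
      using ne[of \<xi>] by (simp add: divide_simps)
  qed
  finally show ?thesis
    unfolding 1 by (simp add: P_def)
qed

definition pole_germ :: "complex \<Rightarrow> complex fps" where
  "pole_germ \<omega> = fps_expansion (\<lambda>z. 1 / (\<omega> - z)) 0"

lemma pole_germ:
  shows fps_conv_radius_pole_germ: "ereal (norm \<omega>) \<le> fps_conv_radius (pole_germ \<omega>)"
    and eval_pole_germ: "norm z < norm \<omega> \<Longrightarrow> eval_fps (pole_germ \<omega>) z = 1 / (\<omega> - z)"
proof -
  have hol: "(\<lambda>z. 1 / (\<omega> - z)) holomorphic_on eball 0 (norm \<omega>)"
    by (auto intro!: holomorphic_intros simp: in_eball_iff)
  from conv_radius_fps_expansion[OF hol] show "ereal (norm \<omega>) \<le> fps_conv_radius (pole_germ \<omega>)"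
    by (simp add: pole_germ_def)
  from eval_fps_expansion'[OF hol] show "norm z < norm \<omega> \<Longrightarrow> eval_fps (pole_germ \<omega>) z = 1 / (\<omega> - z)"
    by (simp add: pole_germ_def)
qed

text \<open>The rational function itself continues its germ along every path that avoids
  \<omega>.\<close>

lemma pole_germ_continuable:
  assumes \<Omega>: "closed \<Omega>" "discrete \<Omega>" and \<omega>: "\<omega> \<in> \<Omega>" "\<omega> \<noteq> 0"
  shows "pole_germ \<omega> \<in> continuable_germs \<Omega>"
proof -
  obtain R0 where R0: "R0 > 0" "ball 0 R0 \<inter> \<Omega> \<subseteq> {0}"
    using discrete_closed_punctured_disc[OF \<Omega>] by blast
  define R where "R = min R0 (norm \<omega>)"
  have "R > 0" using R0 \<omega> by (simp add: R_def)
  moreover have "ereal R \<le> fps_conv_radius (pole_germ \<omega>)"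
    by (rule order.trans[OF _ fps_conv_radius_pole_germ]) (simp add: R_def)
  moreover have "punctured_disc R \<inter> \<Omega> = {}"
    using R0(2) by (auto simp: punctured_disc_def R_def)
  moreover have "continuable_along (eval_fps (pole_germ \<omega>)) \<gamma>"
    if \<gamma>: "path_image \<gamma> \<subseteq> - \<Omega>" "pathstart \<gamma> \<in> punctured_disc R" for \<gamma>
  proof -
    have "coherent_along {0..1} \<gamma> (\<lambda>_ z. 1 / (\<omega> - z))"
    proof (rule coherent_along_const)
      fix t :: real assume "t \<in> {0..1}"
      then have "\<gamma> t \<noteq> \<omega>"
        using \<gamma>(1) \<omega>(1) unfolding path_image_def by blast
      then show "(\<lambda>z. 1 / (\<omega> - z)) analytic_on {\<gamma> t}"
        by (auto intro!: analytic_intros)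
    qed
    moreover have "\<forall>\<^sub>F z in nhds (\<gamma> 0). z \<in> ball 0 (norm \<omega>)"
      using \<gamma>(2) by (intro eventually_nhds_in_open) (auto simp: punctured_disc_def R_def pathstart_def)
    then have "\<forall>\<^sub>F z in nhds (\<gamma> 0). 1 / (\<omega> - z) = eval_fps (pole_germ \<omega>) z"
      by eventually_elim (simp add: eval_pole_germ)
    ultimately show ?thesis
      unfolding continuable_along_def continuation_along_iff by (intro exI[of _ "\<lambda>_ z. 1 / (\<omega> - z)"]) simp
  qed
  ultimately show ?thesis
    unfolding continuable_germs_def Omega_continuable_def by blast
qed

text \<open>Multiplying the continuation of h by \<open>\<omega>1 + \<omega>2 - z\<close> gives a
  family that starts as L. By uniqueness its derivative stays equal to the sum of the poles, so it
  is a primitive along \<gamma>. At the end point the factor vanishes, and only the initial value of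
  L remains.\<close>

lemma contour_integral_along_continuation:
  fixes \<Omega> :: "complex set"
  assumes w: "\<omega>1 \<in> \<Omega>" "\<omega>2 \<in> \<Omega>"
    and \<gamma>: "valid_path \<gamma>" "path_image \<gamma> \<subseteq> - \<Omega>" "pathfinish \<gamma> = \<omega>1 + \<omega>2"
    and F: "continuation_along h \<gamma> F"
    and h: "\<forall>\<^sub>F z in nhds (pathstart \<gamma>). (\<omega>1 + \<omega>2 - z) * h z = L z"
    and L: "\<forall>\<^sub>F z in nhds (pathstart \<gamma>). (L has_field_derivative 1 / (\<omega>1 - z) + 1 / (\<omega>2 - z)) (at z)"
  shows "contour_integral \<gamma> (\<lambda>z. 1 / (\<omega>1 - z) + 1 / (\<omega>2 - z)) = - L (pathstart \<gamma>)"
proof -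
  let ?r = "\<lambda>z. 1 / (\<omega>1 - z) + 1 / (\<omega>2 - z)"
  define T where "T f z = (\<omega>1 + \<omega>2 - z) * f z" for f and z :: complex
  have Fc: "coherent_along {0..1} \<gamma> F" and F0: "\<forall>\<^sub>F z in nhds (pathstart \<gamma>). F 0 z = h z"
    using F by (auto simp: continuation_along_iff pathstart_def)
  have im: "\<gamma> t \<noteq> \<omega>1" "\<gamma> t \<noteq> \<omega>2" if "t \<in> {0..1}" for t
    using \<gamma>(2) w that unfolding path_image_def by blast+
  have G: "coherent_along {0..1} \<gamma> (\<lambda>t. T (F t))"
  proof (rule coherent_along_map[OF Fc])
    show "\<forall>\<^sub>F z in nhds x. T f z = T g z" if "\<forall>\<^sub>F z in nhds x. f z = g z" for f g x
      using that by eventually_elim (simp add: T_def)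
    show "T f analytic_on {\<gamma> t}" if "f analytic_on {\<gamma> t}" for f t
      using that unfolding T_def[abs_def] by (intro analytic_intros)
  qed
  have D: "coherent_along {0..1} \<gamma> (\<lambda>t z. deriv (T (F t)) z - ?r z)"
  proof (rule coherent_along_map[OF G, of "\<lambda>f z. deriv f z - ?r z"])
    show "\<forall>\<^sub>F z in nhds x. deriv f z - ?r z = deriv g z - ?r z" if "\<forall>\<^sub>F z in nhds x. f z = g z" for f g x
      using eventually_deriv_cong[OF that] by eventually_elim simp
    show "(\<lambda>z. deriv f z - ?r z) analytic_on {\<gamma> t}" if "t \<in> {0..1}" "f analytic_on {\<gamma> t}" for f t
      using that im[OF that(1)] by (auto intro!: analytic_intros analytic_deriv)
  qed
  have TL: "\<forall>\<^sub>F z in nhds (pathstart \<gamma>). T (F 0) z = L z"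
    using F0 h by eventually_elim (simp add: T_def)
  from eventually_deriv_cong[OF this] L have "\<forall>\<^sub>F z in nhds (\<gamma> 0). deriv (T (F 0)) z - ?r z = 0"
    unfolding pathstart_def by eventually_elim (simp add: DERIV_imp_deriv)
  then have zero: "\<forall>\<^sub>F z in nhds (\<gamma> t). deriv (T (F t)) z - ?r z = 0" if "t \<in> {0..1}" for t
    using coherent_along_zero[OF D, of 0 t] that \<gamma>(1) by (auto dest: valid_path_imp_path simp: path_def)
  have "(?r has_contour_integral (T (F 1) (\<gamma> 1) - T (F 0) (\<gamma> 0))) \<gamma>"
  proof (rule has_contour_integral_of_local_primitives[OF G \<gamma>(1)])
    fix t :: real assume t: "t \<in> {0..1}"
    have "deriv (T (F t)) (\<gamma> t) = ?r (\<gamma> t)"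
      using eventually_nhds_x_imp_x[OF zero[OF t]] by simp
    moreover have "T (F t) field_differentiable at (\<gamma> t)"
      using coherent_along_analytic[OF G t] by (simp add: analytic_on_imp_differentiable_at)
    ultimately show "(T (F t) has_field_derivative ?r (\<gamma> t)) (at (\<gamma> t))"
      using DERIV_deriv_iff_field_differentiable by metis
  qed
  moreover have "T (F 1) (\<gamma> 1) = 0"
    using \<gamma>(3) by (simp add: T_def pathfinish_def)
  moreover have "T (F 0) (\<gamma> 0) = L (pathstart \<gamma>)"
    using eventually_nhds_x_imp_x[OF TL] by (simp add: pathstart_def)
  ultimately show ?thesis
    by (simp add: contour_integral_unique)
qed

text \<open>If the convolution were continuable, the integral of the sum of the poles from a base
  point to \<open>\<omega>1 + \<omega>2\<close> would be the same for all paths off \<Omega>.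
  Appending a loop with nonzero integral refutes this.\<close>

lemma convolution_of_poles_not_continuable:
  fixes \<Omega> :: "complex set"
  assumes \<Omega>: "closed \<Omega>" "discrete \<Omega>" and w: "\<omega>1 \<in> \<Omega>" "\<omega>2 \<in> \<Omega>" "\<omega>1 \<noteq> 0" "\<omega>2 \<noteq> 0"
    and sum: "\<omega>1 + \<omega>2 \<notin> \<Omega>"
  shows "germ_convolution (pole_germ \<omega>1) (pole_germ \<omega>2) \<notin> continuable_germs \<Omega>"
proof
  let ?h = "germ_convolution (pole_germ \<omega>1) (pole_germ \<omega>2)"
  let ?r = "\<lambda>z. 1 / (\<omega>1 - z) + 1 / (\<omega>2 - z)"
  assume "?h \<in> continuable_germs \<Omega>"
  then obtain R where R: "R > 0" "punctured_disc R \<inter> \<Omega> = {}"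
    and cont: "\<And>\<gamma>. valid_path \<gamma> \<Longrightarrow> path_image \<gamma> \<subseteq> - \<Omega> \<Longrightarrow> pathstart \<gamma> \<in> punctured_disc R \<Longrightarrow>
      continuable_along (eval_fps ?h) \<gamma>"
    unfolding continuable_germs_def Omega_continuable_def by blast
  define L where "L z = - Ln (1 - z / \<omega>1) - Ln (1 - z / \<omega>2)" for z
  have "fps_conv_radius (pole_germ \<omega>) > 0" if "\<omega> \<noteq> 0" for \<omega>
    using fps_conv_radius_pole_germ[of \<omega>] that by (auto intro: less_le_trans[of _ "ereal (norm \<omega>)"])
  then have exp: "(\<lambda>z. contour_integral (linepath 0 z) (\<lambda>\<xi>. eval_fps (pole_germ \<omega>1) \<xi> * eval_fps (pole_germ \<omega>2) (z - \<xi>)))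
      has_fps_expansion ?h"
    using w by (intro germ_convolution_has_fps_expansion) auto
  have "\<forall>\<^sub>F z in nhds 0. z \<in> ball 0 (min R (min (norm \<omega>1) (norm \<omega>2)))"
    using R(1) w by (intro eventually_nhds_in_open) auto
  moreover have "\<forall>\<^sub>F z in nhds 0. eval_fps ?h z =
      contour_integral (linepath 0 z) (\<lambda>\<xi>. eval_fps (pole_germ \<omega>1) \<xi> * eval_fps (pole_germ \<omega>2) (z - \<xi>))"
    using exp by (simp add: has_fps_expansion_def)
  ultimately have "\<forall>\<^sub>F z in nhds 0. norm z < R \<and> norm z < norm \<omega>1 \<and> norm z < norm \<omega>2 \<and>
      (\<omega>1 + \<omega>2 - z) * eval_fps ?h z = L z"
  proof eventually_elim
    case (elim z)
    have "contour_integral (linepath 0 z) (\<lambda>\<xi>. eval_fps (pole_germ \<omega>1) \<xi> * eval_fps (pole_germ \<omega>2) (z - \<xi>)) =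
        contour_integral (linepath 0 z) (\<lambda>\<xi>. 1 / (\<omega>1 - \<xi>) * (1 / (\<omega>2 - (z - \<xi>))))"
    proof (rule contour_integral_eq)
      fix \<xi> assume "\<xi> \<in> path_image (linepath 0 z)"
      then have "norm \<xi> \<le> norm z" "norm (z - \<xi>) \<le> norm z"
        using segment_bound[of \<xi> 0 z] by (auto simp: norm_minus_commute)
      then show "eval_fps (pole_germ \<omega>1) \<xi> * eval_fps (pole_germ \<omega>2) (z - \<xi>) =
          1 / (\<omega>1 - \<xi>) * (1 / (\<omega>2 - (z - \<xi>)))"
        using elim(1) by (simp add: eval_pole_germ)
    qed
    with elim show ?case
      using segment_convolution_of_poles[of z \<omega>1 \<omega>2] by (simp add: L_def)
  qed
  then obtain U where U: "open U" "0 \<in> U" "\<And>z. z \<in> U \<Longrightarrow> norm z < R \<and> norm z < norm \<omega>1 \<and> norm z < norm \<omega>2 \<and>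
      (\<omega>1 + \<omega>2 - z) * eval_fps ?h z = L z"
    unfolding eventually_nhds by blast
  \<comment> \<open>The base point differs from 0 because admissible paths start in the punctured
    disc.\<close>
  obtain z0 where z0: "z0 \<in> U" "z0 \<noteq> 0"
    using U(1,2) not_open_singleton[of "0::complex"] by (metis subset_singletonD subset_iff singletonI empty_iff)
  then have z0_disc: "z0 \<in> punctured_disc R"
    using U(3)[OF z0(1)] by (simp add: punctured_disc_def)
  then have z0_notin: "z0 \<notin> \<Omega>" using R(2) by blast
  have ev: "\<forall>\<^sub>F z in nhds z0. z \<in> U"
    using U(1) z0(1) by (rule eventually_nhds_in_open)
  have hL: "\<forall>\<^sub>F z in nhds z0. (\<omega>1 + \<omega>2 - z) * eval_fps ?h z = L z"
    using ev by eventually_elim (use U(3) in blast)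
  have dL: "\<forall>\<^sub>F z in nhds z0. (L has_field_derivative ?r z) (at z)"
    using ev
  proof eventually_elim
    case (elim z)
    have "((\<lambda>z. - Ln (1 - z / \<omega>1) + - Ln (1 - z / \<omega>2)) has_field_derivative ?r z) (at z)"
      using U(3)[OF elim] by (intro DERIV_add has_field_derivative_Ln_pole) auto
    then show ?case by (simp add: L_def[abs_def])
  qed
  have same: "contour_integral \<gamma> ?r = - L z0"
    if \<gamma>: "valid_path \<gamma>" "path_image \<gamma> \<subseteq> - \<Omega>" "pathstart \<gamma> = z0" "pathfinish \<gamma> = \<omega>1 + \<omega>2" for \<gamma>
  proof -
    obtain F where "continuation_along (eval_fps ?h) \<gamma> F"
      using cont[OF \<gamma>(1,2)] \<gamma>(3) z0_disc unfolding continuable_along_def by blast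
    from contour_integral_along_continuation[OF w(1,2) \<gamma>(1,2,4) this, of L] hL dL \<gamma>(3)
    show ?thesis by simp
  qed
  obtain q where q: "valid_path q" "path_image q \<subseteq> - \<Omega>" "pathstart q = z0" "pathfinish q = \<omega>1 + \<omega>2"
    using discrete_closed_complement_path[OF \<Omega> z0_notin sum] by blast
  obtain l where l: "valid_path l" "path_image l \<subseteq> - \<Omega>" "pathstart l = \<omega>1 + \<omega>2" "pathfinish l = \<omega>1 + \<omega>2"
    and l0: "contour_integral l ?r \<noteq> 0"
    using loop_around_pole[OF \<Omega> w(1,2) sum] by blast
  have "?r holomorphic_on - \<Omega>"
    using w(1,2) by (auto intro!: holomorphic_intros)
  then have "?r contour_integrable_on p" if "valid_path p" "path_image p \<subseteq> - \<Omega>" for p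
    using contour_integrable_holomorphic_simple[OF _ _ that] \<Omega>(1) by (simp add: open_Compl)
  then have "contour_integral (q +++ l) ?r = contour_integral q ?r + contour_integral l ?r"
    using q l by (intro contour_integral_join) auto
  moreover have "contour_integral (q +++ l) ?r = - L z0"
    using q l by (intro same) (auto simp: path_image_join)
  ultimately show False
    using same[OF q] l0 by simp
qed

subsection \<open>The stability criterion\<close>

lemma germ_convolution_continuable:
  assumes \<Omega>: "closed \<Omega>" "\<Omega> \<noteq> {}" "\<And>\<omega> \<omega>'. \<omega> \<in> \<Omega> \<Longrightarrow> \<omega>' \<in> \<Omega> \<Longrightarrow> \<omega> + \<omega>' \<in> \<Omega>"
    and "\<phi> \<in> continuable_germs \<Omega>" "\<psi> \<in> continuable_germs \<Omega>"
  shows "germ_convolution \<phi> \<psi> \<in> continuable_germs \<Omega>"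
proof -
  let ?h = "germ_convolution \<phi> \<psi>"
  let ?I = "\<lambda>z. contour_integral (linepath 0 z) (\<lambda>\<xi>. eval_fps \<phi> \<xi> * eval_fps \<psi> (z - \<xi>))"
  obtain R1 where R1: "R1 > 0" "ereal R1 \<le> fps_conv_radius \<phi>" "punctured_disc R1 \<inter> \<Omega> = {}"
    "continuable_outside \<Omega> R1 (eval_fps \<phi>)"
    using assms(4) unfolding continuable_germs_def Omega_continuable_def continuable_outside_def by blast
  obtain R2 where R2: "R2 > 0" "ereal R2 \<le> fps_conv_radius \<psi>" "continuable_outside \<Omega> R2 (eval_fps \<psi>)"
    using assms(5) unfolding continuable_germs_def Omega_continuable_def continuable_outside_def by blast
  have "fps_conv_radius \<phi> > 0" "fps_conv_radius \<psi> > 0"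
    using R1(1,2) R2(1,2) by (auto intro: less_le_trans[of 0 "ereal _"])
  then have "?I has_fps_expansion ?h"
    by (rule germ_convolution_has_fps_expansion)
  then have rad: "fps_conv_radius ?h > 0" and ev: "\<forall>\<^sub>F z in nhds 0. eval_fps ?h z = ?I z"
    by (auto simp: has_fps_expansion_def)
  obtain R3 where R3: "R3 > 0" "ereal R3 < fps_conv_radius ?h"
    using ereal_dense2[OF rad] by auto
  obtain R4 where R4: "R4 > 0" "\<And>z. dist z 0 < R4 \<Longrightarrow> eval_fps ?h z = ?I z"
    using ev unfolding eventually_nhds_metric by blast
  \<comment> \<open>R1 and R2 serve the two given germs, R3 the convergence of the convolution
    series, and R4 its equality with the integral.\<close>
  define R where "R = min (min R1 R2) (min R3 R4)"
  have R: "R > 0" "R \<le> R1" "R \<le> R2" "R \<le> R3" "R \<le> R4"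
    using R1 R2 R3 R4 by (simp_all add: R_def)
  have mono: "punctured_disc R \<subseteq> punctured_disc R'" if "R \<le> R'" for R'
    using that by (auto simp: punctured_disc_def)
  have "ereal R \<le> ereal R3" using R(4) by simp
  then have "ereal R \<le> fps_conv_radius ?h"
    using R3(2) by (meson less_imp_le order.trans)
  moreover have disc: "punctured_disc R \<inter> \<Omega> = {}"
    using R1(3) mono[OF R(2)] by blast
  moreover have "continuable_along (eval_fps ?h) \<gamma>"
    if \<gamma>: "valid_path \<gamma>" "path_image \<gamma> \<subseteq> - \<Omega>" "pathstart \<gamma> \<in> punctured_disc R" for \<gamma>
  proof (rule convolution_continuable_along[OF \<Omega> disc])
    show "continuable_outside \<Omega> R (eval_fps \<phi>)" "continuable_outside \<Omega> R (eval_fps \<psi>)"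
      using R1(4) R2(3) mono[OF R(2)] mono[OF R(3)] unfolding continuable_outside_def by blast+
    show "eval_fps \<phi> holomorphic_on ball 0 R" "eval_fps \<psi> holomorphic_on ball 0 R"
      using R1(2) R2(2) R(2,3)
      by (auto intro!: eval_fps_holomorphic_on_ball intro: order.trans[of _ "ereal R1"] order.trans[of _ "ereal R2"])
    show "eval_fps ?h z = ?I z" if "norm z < R" for z
      using R4(2)[of z] that R(5) by simp
  qed (use \<gamma> in \<open>auto intro: valid_path_imp_path\<close>)
  ultimately show ?thesis
    using R(1) unfolding continuable_germs_def Omega_continuable_def by blast
qed

theorem theorem21p1:
  fixes \<Omega> :: "complex set"
  assumes "\<Omega> \<noteq> {}" and "closed \<Omega>" and "discrete \<Omega>"
  shows "(\<forall>\<phi>\<in>continuable_germs \<Omega>. \<forall>\<psi>\<in>continuable_germs \<Omega>.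
            germ_convolution \<phi> \<psi> \<in> continuable_germs \<Omega>)
         \<longleftrightarrow> (\<forall>\<omega>\<in>\<Omega>. \<forall>\<omega>'\<in>\<Omega>. \<omega> + \<omega>' \<in> \<Omega>)"
proof
  assume conv: "\<forall>\<phi>\<in>continuable_germs \<Omega>. \<forall>\<psi>\<in>continuable_germs \<Omega>.
      germ_convolution \<phi> \<psi> \<in> continuable_germs \<Omega>"
  show "\<forall>\<omega>\<in>\<Omega>. \<forall>\<omega>'\<in>\<Omega>. \<omega> + \<omega>' \<in> \<Omega>"
  proof (intro ballI)
    fix \<omega> \<omega>' assume w: "\<omega> \<in> \<Omega>" "\<omega>' \<in> \<Omega>"
    show "\<omega> + \<omega>' \<in> \<Omega>"
    \<comment> \<open>A pole at 0 defines no germ at 0, but a zero summand makes the claim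
      trivial.\<close>
    proof (cases "\<omega> = 0 \<or> \<omega>' = 0")
      case True
      then show ?thesis using w by auto
    next
      case False
      then show ?thesis
        using convolution_of_poles_not_continuable[OF assms(2,3) w] conv
          pole_germ_continuable[OF assms(2,3)] w by blast
    qed
  qed
next
  assume "\<forall>\<omega>\<in>\<Omega>. \<forall>\<omega>'\<in>\<Omega>. \<omega> + \<omega>' \<in> \<Omega>"
  then show "\<forall>\<phi>\<in>continuable_germs \<Omega>. \<forall>\<psi>\<in>continuable_germs \<Omega>.
      germ_convolution \<phi> \<psi> \<in> continuable_germs \<Omega>"
    using germ_convolution_continuable[OF assms(2,1)] by blast
qed

end
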